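(* Consider the online allocation problem and Algorithm 1 described in the context, run with step-size $\eta\ge 0$, initial dual solution $\mu_1\in\mathbb{R}^m_+$ and a reference function $h$. Suppose Assumption 1 and Assumption 2 hold and the requests $\gamma_1,\ldots,\gamma_T$ are drawn i.i.d. from a distribution $\mathcal{P}\in\Delta(\mathcal{S})$ unknown to the algorithm. Then for every $T\ge 1$, $$\mathrm{Regret}(A)=\sup_{\mathcal{P}\in\Delta(\mathcal{S})}\mathbb{E}_{\vec\gamma\sim\mathcal{P}^T}\big[\mathrm{OPT}(\vec\gamma)-R(A\mid\vec\gamma)\big]\le C_1+C_2\eta T+\frac{C_3}{\eta},$$ where $C_1=\bar f\bar b/\underline{\rho}$, $C_2=(\bar b+\bar\rho)^2/(2\sigma)$, and $C_3=\max\{V_h(\mu,\mu_1):\mu\in\{0,(\bar f/\rho_1)e_1,\ldots,(\bar f/\rho_m)e_m\}\}$, with $e_j$ the $j$-th unit vector of $\mathbb{R}^m$.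
   Context: Online allocation problem: horizon $T\ge1$, $m\ge1$ resources, dimension $d\ge1$. A request is a triple $\gamma=(f,b,\mathcal{X})$ with $\mathcal{X}\subset\mathbb{R}^d_+$ compact, $0\in\mathcal{X}$, $f:\mathcal{X}\to\mathbb{R}_+$, $b:\mathcal{X}\to\mathbb{R}^m_+$ with $b(0)=0$ (no concavity/convexity assumed). $\mathcal{S}$ is the set of possible requests and $\Delta(\mathcal S)$ the set of probability distributions on it. A resource vector $\rho\in\mathbb{R}^m$ with all $\rho_j>0$ is given; total resources are $T\rho$. Let $\underline\rho=\min_j\rho_j$, $\bar\rho=\max_j\rho_j$. For $\vec\gamma=(\gamma_1,\dots,\gamma_T)$, $\gamma_t=(f_t,b_t,\mathcal X_t)$, $\mathrm{OPT}(\vec\gamma)=\max\{\sum_t f_t(x_t): x_t\in\mathcal X_t,\ \sum_t b_t(x_t)\le T\rho\}$. For an online algorithm $A$ choosing actions $x_t$, $R(A\mid\vec\gamma)=\sum_{t=1}^T f_t(x_t)$. Assumption 1: there exist $\bar f,\bar b\ge 0$ such that for every $(f,b,\mathcal X)\in\mathcal S$: $0\in\mathcal X$; $0\le f(x)\le\bar f$ for all $x\in\mathcal X$; $b(x)\ge0$ and $\|b(x)\|_\infty\le\bar b$ for all $x\in\mathcal X$; and for every $\mu\in\mathbb{R}^m_+$, $\max_{x\in\mathcal X}\{f(x)-\mu^\top b(x)\}$ is attained. Assumption 2: $h:\mathbb{R}^m\to\mathbb{R}$ is differentiable (or essentially smooth) on $\mathbb{R}^m_+$ and $\sigma$-strongly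 convex with respect to $\|\cdot\|_1$ on $\mathbb{R}^m_+$, i.e. $h(\mu_1)\ge h(\mu_2)+\nabla h(\mu_2)^\top(\mu_1-\mu_2)+\frac{\sigma}{2}\|\mu_1-\mu_2\|_1^2$ for all $\mu_1,\mu_2\in\mathbb{R}^m_+$. The Bregman divergence is $V_h(x,y)=h(x)-h(y)-\nabla h(y)^\top(x-y)$. Algorithm 1 (dual mirror descent): set $B_1=T\rho$. For $t=1,\dots,T$: observe $\gamma_t=(f_t,b_t,\mathcal X_t)$; choose $\tilde x_t\in\arg\max_{x\in\mathcal X_t}\{f_t(x)-\mu_t^\top b_t(x)\}$; set $x_t=\tilde x_t$ if $b_t(\tilde x_t)\le B_t$ (componentwise), else $x_t=0$; set $B_{t+1}=B_t-b_t(x_t)$; set $\tilde g_t=\rho-b_t(\tilde x_t)$; set $\mu_{t+1}=\arg\min_{\mu\in\mathbb{R}^m_+}\{\tilde g_t^\top\mu+\frac1\eta V_h(\mu,\mu_t)\}$. *)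

theory Defs
  imports "HOL-Probability.Probability"
begin

text \<open>
  The maps of a request are total functions; only their values on the action set matter.
\<close>

datatype ('d, 'm) request =
  Request
    (reward: "real ^ 'd \<Rightarrow> real")
    (consumption: "real ^ 'd \<Rightarrow> real ^ 'm")
    (actions: "(real ^ 'd) set")

definition valid_request :: "('d::finite, 'm::finite) request \<Rightarrow> bool" where
  "valid_request r \<longleftrightarrow>
     actions r \<subseteq> {0..} \<and> compact (actions r) \<and> 0 \<in> actions r \<and>
     (\<forall>x\<in>actions r. 0 \<le> reward r x) \<and>
     (\<forall>x\<in>actions r. 0 \<le> consumption r x) \<and>
     consumption r 0 = 0"

definition is_lagrangian_maximizer ::
    "('d::finite, 'm::finite) request \<Rightarrow> real ^ 'm \<Rightarrow> real ^ 'd \<Rightarrow> bool" where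
  "is_lagrangian_maximizer r \<mu> x \<longleftrightarrow>
     is_arg_max (\<lambda>y. reward r y - \<mu> \<bullet> consumption r y) (\<lambda>y. y \<in> actions r) x"

definition bounded_requests :: "real \<Rightarrow> real \<Rightarrow> ('d::finite, 'm::finite) request set \<Rightarrow> bool" where
  "bounded_requests fbar bbar S \<longleftrightarrow>
     0 \<le> fbar \<and> 0 \<le> bbar \<and>
     (\<forall>r\<in>S.
        0 \<in> actions r \<and>
        (\<forall>x\<in>actions r. 0 \<le> reward r x \<and> reward r x \<le> fbar) \<and>
        (\<forall>x\<in>actions r. 0 \<le> consumption r x \<and> infnorm (consumption r x) \<le> bbar) \<and>
        (\<forall>\<mu>\<ge>0. \<exists>x. is_lagrangian_maximizer r \<mu> x))"

text \<open>
  For bounded requests the set below is nonempty and bounded, so its supremum is the maximum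
  whenever the latter is attained.
\<close>

definition opt_value ::
    "nat \<Rightarrow> real ^ 'm \<Rightarrow> (nat \<Rightarrow> ('d::finite, 'm::finite) request) \<Rightarrow> real" where
  "opt_value T \<rho> \<gamma> =
     Sup {\<Sum>t=1..T. reward (\<gamma> t) (x t) | x.
            (\<forall>t\<in>{1..T}. x t \<in> actions (\<gamma> t)) \<and>
            (\<Sum>t=1..T. consumption (\<gamma> t) (x t)) \<le> real T *\<^sub>R \<rho>}"

definition total_reward ::
    "nat \<Rightarrow> (nat \<Rightarrow> ('d::finite, 'm::finite) request) \<Rightarrow> (nat \<Rightarrow> real ^ 'd) \<Rightarrow> real" where
  "total_reward T \<gamma> x = (\<Sum>t=1..T. reward (\<gamma> t) (x t))"

text \<open>
  The set of possible requests is the carrier of the measurable space \<open>M\<close>, and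
  \<open>space (prob_algebra M)\<close> consists of all probability measures on it.  An algorithm enters only
  through its action map \<open>x\<close>: on the request sequence \<open>\<gamma>\<close> it plays \<open>x \<gamma> t\<close> at time \<open>t\<close>.
\<close>

definition regret ::
    "nat \<Rightarrow> real ^ 'm \<Rightarrow> ('d::finite, 'm::finite) request measure \<Rightarrow>
     ((nat \<Rightarrow> ('d, 'm) request) \<Rightarrow> nat \<Rightarrow> real ^ 'd) \<Rightarrow> ereal" where
  "regret T \<rho> M x =
     (SUP P\<in>space (prob_algebra M).
        ereal (\<integral>\<gamma>. opt_value T \<rho> \<gamma> - total_reward T \<gamma> (x \<gamma>) \<partial>(\<Pi>\<^sub>M t\<in>{1..T}. P)))"

definition l1_norm :: "real ^ 'm \<Rightarrow> real" where
  "l1_norm v = (\<Sum>j\<in>UNIV. \<bar>v $ j\<bar>)"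

text \<open>
  Differentiability is taken relative to the nonnegative orthant, so that it is only
  one-sided at boundary points; the derivative is still unique there, since the orthant
  contains a segment in each coordinate direction at each of its points.
\<close>

definition orthant_grad :: "(real ^ 'm \<Rightarrow> real) \<Rightarrow> real ^ 'm \<Rightarrow> real ^ 'm" where
  "orthant_grad h y = (\<chi> j. frechet_derivative h (at y within {0..}) (axis j 1))"

definition bregman :: "(real ^ 'm \<Rightarrow> real) \<Rightarrow> real ^ 'm \<Rightarrow> real ^ 'm \<Rightarrow> real" where
  "bregman h x y = h x - h y - orthant_grad h y \<bullet> (x - y)"

definition essentially_smooth_on_orthant :: "(real ^ 'm \<Rightarrow> real) \<Rightarrow> bool" where
  "essentially_smooth_on_orthant h \<longleftrightarrow>
     (\<forall>y\<in>interior {0..}. h differentiable (at y)) \<and>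
     (\<forall>z\<in>frontier {0..}.
        filterlim (\<lambda>y. norm (orthant_grad h y)) at_top (at z within interior {0..}))"

text \<open>
  Strong convexity is required at every base point \<open>v\<close> at which the gradient exists: all of the
  orthant if \<open>h\<close> is differentiable on it, and its interior if \<open>h\<close> is only essentially smooth.
\<close>

definition reference_function :: "real \<Rightarrow> (real ^ 'm \<Rightarrow> real) \<Rightarrow> bool" where
  "reference_function \<sigma> h \<longleftrightarrow>
     0 < \<sigma> \<and>
     (h differentiable_on {0..} \<or> essentially_smooth_on_orthant h) \<and>
     (\<forall>u\<in>{0..}. \<forall>v\<in>{0..}. h differentiable (at v within {0..}) \<longrightarrow>
        h u \<ge> h v + orthant_grad h v \<bullet> (u - v) + \<sigma> / 2 * (l1_norm (u - v))\<^sup>2)"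

text \<open>
  The objective is extended-real valued so that a step size \<open>\<eta> = 0\<close> makes sense: with
  \<open>c / 0 = \<infinity>\<close> for \<open>c > 0\<close> and \<open>0 / 0 = 0\<close>, the minimizer is then the current iterate.
\<close>

definition is_mirror_step ::
    "(real ^ 'm \<Rightarrow> real) \<Rightarrow> real \<Rightarrow> real ^ 'm \<Rightarrow> real ^ 'm \<Rightarrow> real ^ 'm \<Rightarrow> bool" where
  "is_mirror_step h \<eta> g \<mu> \<mu>' \<longleftrightarrow>
     is_arg_min (\<lambda>v. ereal (g \<bullet> v) + ereal (bregman h v \<mu>) / ereal \<eta>) (\<lambda>v. 0 \<le> v) \<mu>'"

text \<open>
  Execution on one request sequence: \<open>xt\<close> are the tentative actions, \<open>x\<close> the actions actually
  taken, \<open>B\<close> the remaining resources and \<open>\<mu>\<close> the dual iterates.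
\<close>

definition mirror_descent_run ::
    "nat \<Rightarrow> real ^ 'm \<Rightarrow> (real ^ 'm \<Rightarrow> real) \<Rightarrow> real \<Rightarrow> real ^ 'm \<Rightarrow>
     (nat \<Rightarrow> ('d::finite, 'm::finite) request) \<Rightarrow>
     (nat \<Rightarrow> real ^ 'd) \<Rightarrow> (nat \<Rightarrow> real ^ 'd) \<Rightarrow> (nat \<Rightarrow> real ^ 'm) \<Rightarrow> (nat \<Rightarrow> real ^ 'm) \<Rightarrow> bool" where
  "mirror_descent_run T \<rho> h \<eta> \<mu>1 \<gamma> xt x B \<mu> \<longleftrightarrow>
     B 1 = real T *\<^sub>R \<rho> \<and>
     \<mu> 1 = \<mu>1 \<and>
     (\<forall>t\<in>{1..T}.
        is_lagrangian_maximizer (\<gamma> t) (\<mu> t) (xt t) \<and>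
        x t = (if consumption (\<gamma> t) (xt t) \<le> B t then xt t else 0) \<and>
        B (t + 1) = B t - consumption (\<gamma> t) (x t) \<and>
        is_mirror_step h \<eta> (\<rho> - consumption (\<gamma> t) (xt t)) (\<mu> t) (\<mu> (t + 1)))"

text \<open>
  Ties in the choice of \<open>xt \<gamma> t\<close> may be broken by any rule that sees only the requests up to
  time \<open>t\<close>; the other components are then determined by the recursion.
\<close>

definition dual_mirror_descent ::
    "nat \<Rightarrow> real ^ 'm \<Rightarrow> (real ^ 'm \<Rightarrow> real) \<Rightarrow> real \<Rightarrow> real ^ 'm \<Rightarrow>
     ('d::finite, 'm::finite) request set \<Rightarrow>
     ((nat \<Rightarrow> ('d, 'm) request) \<Rightarrow> nat \<Rightarrow> real ^ 'd) \<Rightarrow>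
     ((nat \<Rightarrow> ('d, 'm) request) \<Rightarrow> nat \<Rightarrow> real ^ 'd) \<Rightarrow>
     ((nat \<Rightarrow> ('d, 'm) request) \<Rightarrow> nat \<Rightarrow> real ^ 'm) \<Rightarrow>
     ((nat \<Rightarrow> ('d, 'm) request) \<Rightarrow> nat \<Rightarrow> real ^ 'm) \<Rightarrow> bool" where
  "dual_mirror_descent T \<rho> h \<eta> \<mu>1 S xt x B \<mu> \<longleftrightarrow>
     (\<forall>\<gamma>\<in>{1..T} \<rightarrow>\<^sub>E S. mirror_descent_run T \<rho> h \<eta> \<mu>1 \<gamma> (xt \<gamma>) (x \<gamma>) (B \<gamma>) (\<mu> \<gamma>)) \<and>
     (\<forall>\<gamma>\<in>{1..T} \<rightarrow>\<^sub>E S. \<forall>\<gamma>'\<in>{1..T} \<rightarrow>\<^sub>E S. \<forall>t\<in>{1..T}.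
        (\<forall>s\<in>{1..t}. \<gamma> s = \<gamma>' s) \<longrightarrow> xt \<gamma> t = xt \<gamma>' t)"

text \<open>
  The hindsight optimum and the rewards, consumptions and dual iterates along the run are random
  variables; without this the expected regret is not meaningful.
\<close>

definition measurable_execution ::
    "nat \<Rightarrow> real ^ 'm \<Rightarrow> ('d::finite, 'm::finite) request measure \<Rightarrow>
     ((nat \<Rightarrow> ('d, 'm) request) \<Rightarrow> nat \<Rightarrow> real ^ 'd) \<Rightarrow>
     ((nat \<Rightarrow> ('d, 'm) request) \<Rightarrow> nat \<Rightarrow> real ^ 'm) \<Rightarrow> bool" where
  "measurable_execution T \<rho> M xt \<mu> \<longleftrightarrow>
     opt_value T \<rho> \<in> borel_measurable (\<Pi>\<^sub>M t\<in>{1..T}. M) \<and>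
     (\<forall>t\<in>{1..T}.
        (\<lambda>\<gamma>. reward (\<gamma> t) (xt \<gamma> t)) \<in> borel_measurable (\<Pi>\<^sub>M t\<in>{1..T}. M) \<and>
        (\<lambda>\<gamma>. consumption (\<gamma> t) (xt \<gamma> t)) \<in> borel_measurable (\<Pi>\<^sub>M t\<in>{1..T}. M) \<and>
        (\<lambda>\<gamma>. \<mu> \<gamma> t) \<in> borel_measurable (\<Pi>\<^sub>M t\<in>{1..T}. M))"

end

theory Submission imports Defs begin

text \<open>
  Let \<open>mean_opt\<close> be the expected hindsight optimum per step.  By weak duality at the current price
  \<open>\<mu>\<^sub>t\<close>, which depends on the past only, the conditional expectation of
  \<open>reward\<^sub>t + g\<^sub>t \<bullet> \<mu>\<^sub>t\<close>, where \<open>g\<^sub>t\<close> is \<open>\<rho>\<close> minus the tentative consumption, is at least \<open>mean_opt\<close>.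
  Summed up to the first time at which some resource might be exhausted, this bounds the expected
  regret by the expectation of \<open>\<Sum> g\<^sub>t \<bullet> \<mu>\<^sub>t\<close> plus \<open>fbar\<close> for each remaining step.  The regret
  inequality of mirror descent bounds the sum by \<open>\<Sum> g\<^sub>t \<bullet> u\<close> plus the error terms, and a comparator
  \<open>u\<close> that charges only the exhausted resource cancels the remaining steps.

  If \<open>h\<close> is only essentially smooth, the iterates after the first lie in the interior of the orthant, so
  gradients exist along the run.
\<close>

section \<open>Mirror steps on the orthant\<close>

lemma nonneg_vec_iff: "(0::real ^ 'm) \<le> v \<longleftrightarrow> (\<forall>j. 0 \<le> v $ j)"
  by (simp add: less_eq_vec_def)

lemma convex_orthant: "convex {0::real ^ 'm..}"
  by (auto simp: convex_def nonneg_vec_iff)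

lemma inner_nonneg_orthant:
  fixes u v :: "real ^ 'm"
  assumes "0 \<le> u" "0 \<le> v"
  shows "0 \<le> u \<bullet> v"
  using assms by (auto simp: inner_vec_def nonneg_vec_iff intro!: sum_nonneg)

lemma l1_norm_nonneg: "0 \<le> l1_norm v"
  by (simp add: l1_norm_def sum_nonneg)

lemma l1_norm_eq_0_iff: "l1_norm v = 0 \<longleftrightarrow> v = 0"
  by (simp add: l1_norm_def sum_nonneg_eq_0_iff vec_eq_iff)

text \<open>Hoelder's inequality for the l1 norm and its dual, the sup norm. It is what matches
  strong convexity in the l1 norm with entrywise bounds on the gradients.\<close>

lemma inner_le_l1_norm:
  assumes "\<And>j. \<bar>g $ j\<bar> \<le> G"
  shows "g \<bullet> v \<le> G * l1_norm v"
proof -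
  have "g \<bullet> v = (\<Sum>j\<in>UNIV. g $ j * v $ j)" by (simp add: inner_vec_def)
  also have "\<dots> \<le> (\<Sum>j\<in>UNIV. G * \<bar>v $ j\<bar>)"
  proof (rule sum_mono)
    fix j
    have "g $ j * v $ j \<le> \<bar>g $ j\<bar> * \<bar>v $ j\<bar>" by (metis abs_ge_self abs_mult)
    also have "\<dots> \<le> G * \<bar>v $ j\<bar>" using assms[of j] by (intro mult_right_mono) auto
    finally show "g $ j * v $ j \<le> G * \<bar>v $ j\<bar>" .
  qed
  finally show ?thesis by (simp add: l1_norm_def sum_distrib_left)
qed

text \<open>A linear map is determined by its values on the unit vectors, so the coordinatewise
  \<open>orthant_grad\<close> represents the relative derivative, at boundary points too.\<close>

lemma has_derivative_orthant_grad:
  assumes "h differentiable (at y within {0..})"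
  shows "(h has_derivative (\<lambda>v. orthant_grad h y \<bullet> v)) (at y within {0..})"
proof -
  let ?D = "frechet_derivative h (at y within {0..})"
  have D: "(h has_derivative ?D) (at y within {0..})"
    using assms frechet_derivative_works by blast
  then interpret linear ?D by (rule has_derivative_linear)
  have "?D v = orthant_grad h y \<bullet> v" for v
  proof -
    have "?D v = ?D (\<Sum>j\<in>UNIV. (v $ j) *\<^sub>R axis j 1)"
      by (simp add: basis_expansion flip: scalar_mult_eq_scaleR)
    also have "\<dots> = (\<Sum>j\<in>UNIV. v $ j * ?D (axis j 1))" by (simp add: sum scale)
    finally show ?thesis by (simp add: inner_vec_def orthant_grad_def mult.commute)
  qed
  then have "?D = (\<lambda>v. orthant_grad h y \<bullet> v)" by blast
  with D show ?thesis by simp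
qed

section \<open>Bregman divergences\<close>

lemma bregman_self: "bregman h v v = 0"
  by (simp add: bregman_def)

lemma bregman_ge:
  assumes "reference_function \<sigma> h" "0 \<le> u" "0 \<le> v" "h differentiable (at v within {0..})"
  shows "bregman h u v \<ge> \<sigma> / 2 * (l1_norm (u - v))\<^sup>2"
proof -
  have "h u \<ge> h v + orthant_grad h v \<bullet> (u - v) + \<sigma> / 2 * (l1_norm (u - v))\<^sup>2"
    using assms unfolding reference_function_def by simp
  then show ?thesis by (simp add: bregman_def)
qed

lemma bregman_nonneg:
  assumes "reference_function \<sigma> h" "0 \<le> u" "0 \<le> v" "h differentiable (at v within {0..})"
  shows "0 \<le> bregman h u v"
proof -
  have "0 \<le> \<sigma> / 2 * (l1_norm (u - v))\<^sup>2"
    using assms(1) by (simp add: reference_function_def)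
  with bregman_ge[OF assms] show ?thesis by linarith
qed

section \<open>First-order optimality of mirror steps\<close>

lemma mirror_step_nonneg:
  assumes "is_mirror_step h \<eta> g \<mu> \<mu>'"
  shows "0 \<le> \<mu>'"
  using assms by (simp add: is_mirror_step_def is_arg_min_def)

text \<open>For \<eta> > 0 the extended-real objective is finite, and scaling it by \<eta> leaves a
  real inequality without division.\<close>

lemma mirror_step_le:
  assumes "is_mirror_step h \<eta> g \<mu> \<mu>'" "0 < \<eta>" "0 \<le> v"
  shows "\<eta> * (g \<bullet> \<mu>') + bregman h \<mu>' \<mu> \<le> \<eta> * (g \<bullet> v) + bregman h v \<mu>"
proof -
  have "ereal (g \<bullet> v) + ereal (bregman h v \<mu>) / ereal \<eta>
      = ereal ((\<eta> * (g \<bullet> v) + bregman h v \<mu>) / \<eta>)" for v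
    using assms(2) by (simp add: add_divide_distrib)
  with assms have "(\<eta> * (g \<bullet> \<mu>') + bregman h \<mu>' \<mu>) / \<eta> \<le> (\<eta> * (g \<bullet> v) + bregman h v \<mu>) / \<eta>"
    by (auto simp: is_mirror_step_def is_arg_min_def not_less)
  with assms(2) show ?thesis by (simp add: divide_le_cancel)
qed

text \<open>Were the directional derivative from \<open>z\<close> towards \<open>u\<close> negative,
  a short move along the segment, which stays in the orthant by convexity, would lower the
  objective.\<close>

lemma orthant_minimizer_inner_nonneg:
  assumes diff: "h differentiable (at z within {0..})" and "0 \<le> z" "0 \<le> u"
    and min: "\<And>v. 0 \<le> v \<Longrightarrow> h z + c \<bullet> z \<le> h v + c \<bullet> v"
  shows "0 \<le> (orthant_grad h z + c) \<bullet> (u - z)"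
proof (rule ccontr)
  let ?\<phi> = "\<lambda>s::real. h (z + s *\<^sub>R (u - z)) + c \<bullet> (z + s *\<^sub>R (u - z))"
  let ?l = "(orthant_grad h z + c) \<bullet> (u - z)"
  assume "\<not> 0 \<le> ?l"
  then have neg: "?l < 0" by simp
  have seg: "0 \<le> z + s *\<^sub>R (u - z)" if "s \<in> {0..1}" for s
  proof -
    have "(1 - s) *\<^sub>R z + s *\<^sub>R u \<in> {0..}"
      using convex_orthant assms that unfolding convex_alt by fastforce
    then show ?thesis by (simp add: algebra_simps)
  qed
  have "(h has_derivative (\<lambda>v. orthant_grad h z \<bullet> v))
      (at (z + 0 *\<^sub>R (u - z)) within (\<lambda>s. z + s *\<^sub>R (u - z)) ` {0..1})"
    using has_derivative_orthant_grad[OF diff] seg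
    by (auto intro: has_derivative_subset)
  then have "((\<lambda>s. h (z + s *\<^sub>R (u - z))) has_derivative (\<lambda>s. orthant_grad h z \<bullet> (s *\<^sub>R (u - z))))
      (at 0 within {0..1})"
    by (rule has_derivative_in_compose[rotated]) (auto intro!: derivative_eq_intros)
  then have "(?\<phi> has_derivative (\<lambda>s. orthant_grad h z \<bullet> (s *\<^sub>R (u - z)) + c \<bullet> (s *\<^sub>R (u - z))))
      (at 0 within {0..1})"
    by (auto intro!: derivative_eq_intros)
  moreover have "(\<lambda>s. orthant_grad h z \<bullet> (s *\<^sub>R (u - z)) + c \<bullet> (s *\<^sub>R (u - z))) = (*) ?l"
    by (auto simp: algebra_simps)
  ultimately have "(?\<phi> has_real_derivative ?l) (at 0 within {0..1})"
    by (simp add: has_field_derivative_def)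
  from has_real_derivative_neg_dec_right[OF this neg] obtain d where "d > 0"
    and d: "\<And>s. 0 < s \<Longrightarrow> 0 + s \<in> {0..1} \<Longrightarrow> s < d \<Longrightarrow> ?\<phi> (0 + s) < ?\<phi> 0"
    by auto
  define s where "s = min 1 (d / 2)"
  have s: "0 < s" "s \<in> {0..1}" "s < d" using \<open>d > 0\<close> by (auto simp: s_def)
  with d[of s] have "?\<phi> s < ?\<phi> 0" by simp
  with min[OF seg[OF s(2)]] show False by simp
qed

text \<open>
  Along a segment from a boundary point \<open>z\<close> to an interior point, the blow-up of the gradient
  forces the directional derivative to \<open>-\<infinity>\<close>, so \<open>z\<close> cannot be a minimizer.  In particular
  no continuity of \<open>h\<close> at the boundary is needed.
\<close>

lemma essentially_smooth_minimizer_interior: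
  fixes h :: "real ^ 'm \<Rightarrow> real"
  assumes ref: "reference_function \<sigma> h" and smooth: "essentially_smooth_on_orthant h" and "0 \<le> z"
    and min: "\<And>v. 0 \<le> v \<Longrightarrow> h z + c \<bullet> z \<le> h v + c \<bullet> v"
  shows "z \<in> interior {0..}"
proof (rule ccontr)
  assume "z \<notin> interior {0..}"
  then have "z \<in> frontier {0..}"
    using \<open>0 \<le> z\<close> closure_subset[of "{0::real ^ 'm..}"] by (auto simp: frontier_def)
  then have blowup:
      "filterlim (\<lambda>y. norm (orthant_grad h y)) at_top (at z within interior {0..})"
    using smooth by (simp add: essentially_smooth_on_orthant_def)
  have diff: "h differentiable (at y)" if "y \<in> interior {0..}" for y
    using smooth that by (simp add: essentially_smooth_on_orthant_def)
  have interior_nonneg: "0 \<le> y" if "y \<in> interior {0..}" for y :: "real ^ 'm"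
    using subsetD[OF interior_subset that] by simp
  \<comment> \<open>Strong convexity without its quadratic term. The base point \<open>y\<close> is
    interior, but \<open>u\<close> may lie on the boundary, so \<open>u = z\<close> is
    allowed.\<close>
  have subgrad: "h u \<ge> h y + orthant_grad h y \<bullet> (u - y)"
    if "0 \<le> u" "y \<in> interior {0..}" for u y
  proof -
    have "h differentiable (at y within {0..})"
      using diff[OF that(2)] by (rule differentiable_at_withinI)
    with bregman_nonneg[OF ref that(1) interior_nonneg[OF that(2)]]
    show ?thesis by (simp add: bregman_def)
  qed
  \<comment> \<open>The all-ones vector is the midpoint of a box inside the orthant, hence an
    interior point.\<close>
  define y0 :: "real ^ 'm" where "y0 = (\<chi> j. 1)"
  have "box 0 (2 *\<^sub>R y0) \<subseteq> {0..}"
  proof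
    fix v assume "v \<in> box 0 (2 *\<^sub>R y0)"
    then have "0 < v $ j" for j by (simp add: mem_box_cart)
    then show "v \<in> {0..}" by (simp add: nonneg_vec_iff order.strict_implies_order)
  qed
  then have "box 0 (2 *\<^sub>R y0) \<subseteq> interior {0..}"
    by (rule interior_maximal) (rule open_box)
  moreover have "y0 \<in> box 0 (2 *\<^sub>R y0)" by (simp add: mem_box_cart y0_def)
  ultimately have y0: "y0 \<in> interior {0..}" by (rule subsetD)
  then obtain \<delta> where "\<delta> > 0" and \<delta>: "cball y0 \<delta> \<subseteq> interior {0..}"
    by (meson open_contains_cball open_interior)
  have "isCont h v" if "v \<in> cball y0 \<delta>" for v
    using diff[OF subsetD[OF \<delta> that]] by (rule differentiable_imp_continuous_within)
  then have "continuous_on (cball y0 \<delta>) h"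
    by (intro continuous_at_imp_continuous_on ballI)
  then have "bdd_above (h ` cball y0 \<delta>)"
    by (intro bounded_imp_bdd_above compact_imp_bounded compact_continuous_image) auto
  then obtain K where K: "\<And>v. v \<in> cball y0 \<delta> \<Longrightarrow> h v \<le> K"
    unfolding bdd_above_def by blast
  define d where "d = y0 - z"
  \<comment> \<open>A lower bound of \<open>h\<close> along the open segment from \<open>z\<close>
    to \<open>y0\<close>, from the gradient inequality based at \<open>y0\<close> and
    Cauchy-Schwarz.\<close>
  define m0 where "m0 = h y0 - norm (orthant_grad h y0) * norm d"
  define y where "y s = z + s *\<^sub>R d" for s :: real
  have y_interior: "y s \<in> interior {0..}" if "0 < s" "s < 1" for s
  proof -
    have "y s = z - s *\<^sub>R (z - y0)" by (simp add: y_def d_def algebra_simps)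
    moreover have "z \<in> closure {0..}" using \<open>0 \<le> z\<close> by (intro subsetD[OF closure_subset]) simp
    then have "z - s *\<^sub>R (z - y0) \<in> interior {0..}"
      using that by (intro mem_interior_closure_convex_shrink[OF convex_orthant y0]) auto
    ultimately show ?thesis by simp
  qed
  \<comment> \<open>The bound is uniform in \<open>s\<close>, which contradicts the blow-up as
    \<open>y s\<close> approaches \<open>z\<close>.\<close>
  have grad_bound: "norm (orthant_grad h (y s)) \<le> (K - m0 + \<bar>c \<bullet> d\<bar>) / \<delta>" if s: "0 < s" "s < 1" for s
  proof -
    define g where "g = orthant_grad h (y s)"
    note int = y_interior[OF s]
    have "h z \<ge> h (y s) - s * (g \<bullet> d)"
      using subgrad[OF \<open>0 \<le> z\<close> int] by (simp add: g_def y_def inner_simps)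
    moreover have "h z + c \<bullet> z \<le> h (y s) + c \<bullet> z + s * (c \<bullet> d)"
      using min[OF interior_nonneg[OF int]] by (simp add: y_def inner_simps)
    ultimately have "s * (- (c \<bullet> d)) \<le> s * (g \<bullet> d)" by simp
    \<comment> \<open>Minimality of \<open>z\<close>, compared with the gradient inequality based at
      \<open>y s\<close> and tested at \<open>z\<close>, keeps the slope along the segment bounded
      below.\<close>
    then have gd: "- (c \<bullet> d) \<le> g \<bullet> d" using s by (simp only: mult_le_cancel_left_pos)
    have "y0 - y s = (1 - s) *\<^sub>R d" by (simp add: y_def d_def algebra_simps)
    then have "norm (y0 - y s) \<le> norm d" using s by (simp add: mult_left_le_one_le)
    then have "orthant_grad h y0 \<bullet> (y0 - y s) \<le> norm (orthant_grad h y0) * norm d"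
      by (intro order_trans[OF norm_cauchy_schwarz] mult_left_mono) auto
    moreover have "h (y s) \<ge> h y0 - orthant_grad h y0 \<bullet> (y0 - y s)"
      using subgrad[OF interior_nonneg[OF int] y0] by (simp add: inner_simps)
    ultimately have m0: "m0 \<le> h (y s)" by (simp add: m0_def)
    \<comment> \<open>The point of the ball farthest in direction \<open>g\<close>: testing the
      gradient inequality there produces \<open>\<delta> * norm g\<close>, while \<open>h u\<close>
      is at most \<open>K\<close>.\<close>
    define u where "u = y0 + \<delta> *\<^sub>R sgn g"
    have u: "u \<in> cball y0 \<delta>" using \<open>\<delta> > 0\<close> by (simp add: u_def dist_norm norm_sgn)
    then have "0 \<le> u" using \<delta> interior_nonneg by blast
    have "u - y s = (1 - s) *\<^sub>R d + \<delta> *\<^sub>R sgn g"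
      by (simp add: u_def y_def d_def algebra_simps)
    moreover have "g \<bullet> sgn g = norm g"
      by (cases "g = 0") (simp_all add: sgn_div_norm dot_square_norm power2_eq_square)
    ultimately have "g \<bullet> (u - y s) = (1 - s) * (g \<bullet> d) + \<delta> * norm g"
      by (simp only: inner_add_right inner_scaleR_right)
    then have "h u \<ge> h (y s) + (1 - s) * (g \<bullet> d) + \<delta> * norm g"
      using subgrad[OF \<open>0 \<le> u\<close> int, folded g_def] by linarith
    moreover have "(1 - s) * (g \<bullet> d) \<ge> - \<bar>c \<bullet> d\<bar>"
    proof -
      have "(1 - s) * (g \<bullet> d) \<ge> (1 - s) * (- \<bar>c \<bullet> d\<bar>)"
        using gd s by (intro mult_left_mono) auto
      moreover have "(1 - s) * \<bar>c \<bullet> d\<bar> \<le> \<bar>c \<bullet> d\<bar>" using s by (intro mult_left_le_one_le) auto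
      ultimately show ?thesis by simp
    qed
    ultimately have "norm g * \<delta> \<le> K - m0 + \<bar>c \<bullet> d\<bar>" using K[OF u] m0 unfolding mult.commute[of "norm g"] by linarith
    then show ?thesis using \<open>\<delta> > 0\<close> by (simp add: g_def pos_le_divide_eq)
  qed
  have "d \<noteq> 0" using y0 \<open>z \<notin> interior {0..}\<close> by (auto simp: d_def)
  have "filterlim y (at z within interior {0..}) (at_right 0)"
    unfolding filterlim_at
  proof
    have "(y \<longlongrightarrow> z + 0 *\<^sub>R d) (at_right 0)" unfolding y_def by (intro tendsto_intros)
    then show "(y \<longlongrightarrow> z) (at_right 0)" by simp
    show "\<forall>\<^sub>F s in at_right 0. y s \<in> interior {0..} \<and> y s \<noteq> z"
      unfolding eventually_at_right_field
      using y_interior \<open>d \<noteq> 0\<close> by (intro exI[of _ 1]) (auto simp: y_def)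
  qed
  then have "filterlim (\<lambda>s. norm (orthant_grad h (y s))) at_top (at_right 0)"
    using filterlim_compose[OF blowup] by blast
  then have "\<forall>\<^sub>F s in at_right 0. (K - m0 + \<bar>c \<bullet> d\<bar>) / \<delta> < norm (orthant_grad h (y s))"
    by (simp add: filterlim_at_top_dense)
  moreover have "\<forall>\<^sub>F s::real in at_right 0. 0 < s \<and> s < 1"
    unfolding eventually_at_right_field by (intro exI[of _ 1]) auto
  ultimately have "\<forall>\<^sub>F s::real in at_right 0. False"
    by eventually_elim (metis grad_bound not_less)
  then show False by simp
qed

text \<open>The divergence differs from \<open>h\<close> by an affine function of its first
  argument, so a mirror step minimizes \<open>h\<close> plus a linear term, the form used by the two
  minimizer lemmas above.\<close>

lemma mirror_step_linear_minimizer: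
  assumes "is_mirror_step h \<eta> g \<mu> \<mu>'" "0 < \<eta>" "0 \<le> v"
  shows "h \<mu>' + (\<eta> *\<^sub>R g - orthant_grad h \<mu>) \<bullet> \<mu>' \<le> h v + (\<eta> *\<^sub>R g - orthant_grad h \<mu>) \<bullet> v"
  using mirror_step_le[OF assms] by (simp add: bregman_def inner_simps algebra_simps)

lemma mirror_step_differentiable:
  assumes ref: "reference_function \<sigma> h" and step: "is_mirror_step h \<eta> g \<mu> \<mu>'" and "0 < \<eta>"
  shows "h differentiable (at \<mu>' within {0..})"
proof -
  have \<mu>': "0 \<le> \<mu>'" by (rule mirror_step_nonneg[OF step])
  consider "h differentiable_on {0..}" | "essentially_smooth_on_orthant h"
    using ref by (auto simp: reference_function_def)
  then show ?thesis
  proof cases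
    case 1
    with \<mu>' show ?thesis by (simp add: differentiable_on_def)
  next
    case 2
    then have "\<mu>' \<in> interior {0..}"
      using mirror_step_linear_minimizer[OF step \<open>0 < \<eta>\<close>]
      by (rule essentially_smooth_minimizer_interior[OF ref _ \<mu>'])
    with 2 have "h differentiable (at \<mu>')"
      unfolding essentially_smooth_on_orthant_def by blast
    then show ?thesis by (rule differentiable_at_withinI)
  qed
qed

text \<open>The variational inequality at the minimizer, rewritten by the three-point identity of
  Bregman divergences.\<close>

lemma mirror_step_three_point:
  assumes ref: "reference_function \<sigma> h" and step: "is_mirror_step h \<eta> g \<mu> \<mu>'" and "0 < \<eta>" "0 \<le> u"
  shows "\<eta> * (g \<bullet> (\<mu>' - u)) \<le> bregman h u \<mu> - bregman h u \<mu>' - bregman h \<mu>' \<mu>"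
proof -
  have "0 \<le> \<mu>'" by (rule mirror_step_nonneg[OF step])
  then have "0 \<le> (orthant_grad h \<mu>' + (\<eta> *\<^sub>R g - orthant_grad h \<mu>)) \<bullet> (u - \<mu>')"
    by (intro orthant_minimizer_inner_nonneg mirror_step_differentiable[OF ref step \<open>0 < \<eta>\<close>]
        mirror_step_linear_minimizer[OF step \<open>0 < \<eta>\<close>] \<open>0 \<le> u\<close>)
  then show ?thesis by (simp add: bregman_def inner_simps algebra_simps)
qed

text \<open>Minimality of \<open>u\<close> and the three-point inequality at \<open>v\<close> with
  comparator \<open>u\<close> give \<open>bregman h u v \<le> 0\<close>; strong convexity then
  forces equality. Uniqueness makes the next price a function of the past.\<close>

lemma mirror_step_unique:
  assumes ref: "reference_function \<sigma> h"
    and u: "is_mirror_step h \<eta> g \<mu> u" and v: "is_mirror_step h \<eta> g \<mu> v" and "0 < \<eta>"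
  shows "u = v"
proof -
  have nonneg: "0 \<le> u" "0 \<le> v" using u v by (auto dest: mirror_step_nonneg)
  have "\<eta> * (g \<bullet> u) + bregman h u \<mu> \<le> \<eta> * (g \<bullet> v) + bregman h v \<mu>"
    by (rule mirror_step_le[OF u \<open>0 < \<eta>\<close> nonneg(2)])
  moreover have "\<eta> * (g \<bullet> (v - u)) \<le> bregman h u \<mu> - bregman h u v - bregman h v \<mu>"
    by (rule mirror_step_three_point[OF ref v \<open>0 < \<eta>\<close> nonneg(1)])
  ultimately have "bregman h u v \<le> 0" by (simp add: inner_simps algebra_simps)
  moreover have "\<sigma> / 2 * (l1_norm (u - v))\<^sup>2 \<le> bregman h u v"
    by (rule bregman_ge[OF ref nonneg mirror_step_differentiable[OF ref v \<open>0 < \<eta>\<close>]])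
  moreover have "0 < \<sigma>" using ref by (simp add: reference_function_def)
  ultimately have "(l1_norm (u - v))\<^sup>2 \<le> 0"
    by (smt (verit) divide_pos_pos mult_pos_pos)
  then show ?thesis by (simp add: l1_norm_eq_0_iff)
qed

text \<open>Split \<open>\<mu> - u\<close> at \<open>\<mu>'\<close>. The three-point inequality
  handles \<open>\<mu>' - u\<close> and leaves \<open>- bregman h \<mu>' \<mu>\<close>, whose strong
  convexity absorbs the movement term \<open>g \<bullet> (\<mu> - \<mu>')\<close>.\<close>

lemma mirror_step_regret:
  assumes ref: "reference_function \<sigma> h" and step: "is_mirror_step h \<eta> g \<mu> \<mu>'" and "0 < \<eta>"
    and "0 \<le> \<mu>" "h differentiable (at \<mu> within {0..})" "0 \<le> u" and g: "\<And>j. \<bar>g $ j\<bar> \<le> G"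
  shows "g \<bullet> (\<mu> - u) \<le> \<eta> * G\<^sup>2 / (2 * \<sigma>) + (bregman h u \<mu> - bregman h u \<mu>') / \<eta>"
proof -
  define D where "D = l1_norm (\<mu>' - \<mu>)"
  have \<sigma>: "0 < \<sigma>" using ref by (simp add: reference_function_def)
  have "0 \<le> \<mu>'" by (rule mirror_step_nonneg[OF step])
  then have V: "\<sigma> / 2 * D\<^sup>2 \<le> bregman h \<mu>' \<mu>"
    using bregman_ge[OF ref _ assms(4,5)] by (simp add: D_def)
  have "g \<bullet> (\<mu> - \<mu>') \<le> G * l1_norm (\<mu> - \<mu>')" by (rule inner_le_l1_norm[OF g])
  also have "l1_norm (\<mu> - \<mu>') = D" by (simp add: D_def l1_norm_def abs_minus_commute)
  finally have "\<eta> * (g \<bullet> (\<mu> - \<mu>')) \<le> \<eta> * (G * D)" using \<open>0 < \<eta>\<close> by simp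
  \<comment> \<open>Young's inequality, by completing the square.\<close>
  moreover have "\<eta> * (G * D) - \<sigma> / 2 * D\<^sup>2 \<le> \<eta>\<^sup>2 * G\<^sup>2 / (2 * \<sigma>)"
  proof -
    have "0 \<le> (\<eta> * G - \<sigma> * D)\<^sup>2" by simp
    then show ?thesis using \<sigma> by (simp add: field_simps power2_eq_square)
  qed
  moreover have "\<eta> * (g \<bullet> (\<mu>' - u)) \<le> bregman h u \<mu> - bregman h u \<mu>' - bregman h \<mu>' \<mu>"
    by (rule mirror_step_three_point[OF ref step \<open>0 < \<eta>\<close> \<open>0 \<le> u\<close>])
  ultimately have "\<eta> * (g \<bullet> (\<mu> - u)) \<le> \<eta>\<^sup>2 * G\<^sup>2 / (2 * \<sigma>) + (bregman h u \<mu> - bregman h u \<mu>')"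
    using V by (simp add: inner_simps algebra_simps)
  then have "g \<bullet> (\<mu> - u) \<le> (\<eta>\<^sup>2 * G\<^sup>2 / (2 * \<sigma>) + (bregman h u \<mu> - bregman h u \<mu>')) / \<eta>"
    using \<open>0 < \<eta>\<close> by (simp add: pos_le_divide_eq mult.commute)
  also have "\<dots> = \<eta> * G\<^sup>2 / (2 * \<sigma>) + (bregman h u \<mu> - bregman h u \<mu>') / \<eta>"
    using \<open>0 < \<eta>\<close> by (simp add: add_divide_distrib power2_eq_square)
  finally show ?thesis .
qed

text \<open>Compare the step with staying at \<open>\<mu>\<close>: the divergence grows
  quadratically in the distance moved, the gain only linearly. This keeps the prices bounded, which
  integrability requires.\<close>

lemma mirror_step_l1_bound:
  assumes ref: "reference_function \<sigma> h" and step: "is_mirror_step h \<eta> g \<mu> \<mu>'" and "0 < \<eta>"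
    and "0 \<le> \<mu>" "h differentiable (at \<mu> within {0..})" and g: "\<And>j. \<bar>g $ j\<bar> \<le> G"
  shows "l1_norm (\<mu>' - \<mu>) \<le> 2 * \<eta> * G / \<sigma>"
proof -
  define D where "D = l1_norm (\<mu>' - \<mu>)"
  have \<sigma>: "0 < \<sigma>" using ref by (simp add: reference_function_def)
  have G: "0 \<le> G" using g by (meson abs_ge_zero order_trans)
  have "0 \<le> \<mu>'" by (rule mirror_step_nonneg[OF step])
  then have V: "\<sigma> / 2 * D\<^sup>2 \<le> bregman h \<mu>' \<mu>"
    using bregman_ge[OF ref _ assms(4,5)] by (simp add: D_def)
  have "\<eta> * (g \<bullet> \<mu>') + bregman h \<mu>' \<mu> \<le> \<eta> * (g \<bullet> \<mu>)"
    using mirror_step_le[OF step \<open>0 < \<eta>\<close> \<open>0 \<le> \<mu>\<close>] by (simp add: bregman_self)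
  then have "bregman h \<mu>' \<mu> \<le> \<eta> * (g \<bullet> (\<mu> - \<mu>'))" by (simp add: inner_simps algebra_simps)
  also have "\<dots> \<le> \<eta> * (G * l1_norm (\<mu> - \<mu>'))"
    using \<open>0 < \<eta>\<close> by (intro mult_left_mono inner_le_l1_norm[OF g]) auto
  also have "l1_norm (\<mu> - \<mu>') = D" by (simp add: D_def l1_norm_def abs_minus_commute)
  finally have "D * (\<sigma> * D) \<le> D * (2 * \<eta> * G)" using V by (simp add: power2_eq_square mult_ac)
  moreover have "0 \<le> D" by (simp add: D_def l1_norm_nonneg)
  ultimately have "\<sigma> * D \<le> 2 * \<eta> * G"
    using G \<open>0 < \<eta>\<close> by (cases "D = 0") auto
  then show ?thesis using \<sigma> by (simp add: D_def pos_le_divide_eq mult.commute)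
qed

section \<open>Lagrangian duality for requests\<close>

text \<open>The dual function of one request, without the budget term
  \<open>\<nu> \<bullet> \<rho>\<close>. As a supremum it is independent of how ties between
  maximizers are broken.\<close>

definition dual_value :: "('d::finite, 'm::finite) request \<Rightarrow> real ^ 'm \<Rightarrow> real" where
  "dual_value r \<nu> = Sup ((\<lambda>x. reward r x - \<nu> \<bullet> consumption r x) ` actions r)"

lemma lagrangian_maximizer_actions:
  "is_lagrangian_maximizer r \<nu> x \<Longrightarrow> x \<in> actions r"
  by (simp add: is_lagrangian_maximizer_def is_arg_max_def)

lemma lagrangian_maximizer_ge:
  assumes "is_lagrangian_maximizer r \<nu> x" "y \<in> actions r"
  shows "reward r y - \<nu> \<bullet> consumption r y \<le> reward r x - \<nu> \<bullet> consumption r x"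
  using assms by (simp add: is_lagrangian_maximizer_def is_arg_max_linorder)

lemma dual_value_eq:
  assumes "is_lagrangian_maximizer r \<nu> x"
  shows "dual_value r \<nu> = reward r x - \<nu> \<bullet> consumption r x"
  unfolding dual_value_def
  by (rule cSup_eq_maximum)
    (auto intro: lagrangian_maximizer_actions[OF assms] lagrangian_maximizer_ge[OF assms])

lemma request_boundsD:
  assumes "bounded_requests fbar bbar S" "r \<in> S" "y \<in> actions r"
  shows "0 \<le> reward r y" "reward r y \<le> fbar"
    "0 \<le> consumption r y $ j" "consumption r y $ j \<le> bbar"
proof -
  have "0 \<le> consumption r y" "infnorm (consumption r y) \<le> bbar"
    using assms by (auto simp: bounded_requests_def)
  then show "0 \<le> consumption r y $ j" "consumption r y $ j \<le> bbar"
    using component_le_infnorm_cart[of "consumption r y" j] by (auto simp: nonneg_vec_iff)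
qed (use assms in \<open>auto simp: bounded_requests_def\<close>)

lemma lagrangian_maximizer_exists:
  assumes "bounded_requests fbar bbar S" "r \<in> S" "0 \<le> \<nu>"
  obtains x where "is_lagrangian_maximizer r \<nu> x"
  using assms unfolding bounded_requests_def by blast

lemma dual_value_ge:
  assumes "bounded_requests fbar bbar S" "r \<in> S" "0 \<le> \<nu>" "y \<in> actions r"
  shows "reward r y - \<nu> \<bullet> consumption r y \<le> dual_value r \<nu>"
proof -
  obtain x where "is_lagrangian_maximizer r \<nu> x"
    using lagrangian_maximizer_exists[OF assms(1-3)] .
  then show ?thesis
    using lagrangian_maximizer_ge[OF _ assms(4)] by (simp add: dual_value_eq)
qed

lemma dual_value_bounds:
  assumes bounded: "bounded_requests fbar bbar S" and "r \<in> S" "valid_request r" "0 \<le> \<nu>"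
  shows "0 \<le> dual_value r \<nu>" "dual_value r \<nu> \<le> fbar"
proof -
  have "0 \<in> actions r" "consumption r 0 = 0" "0 \<le> reward r 0"
    using \<open>valid_request r\<close> by (auto simp: valid_request_def)
  then show "0 \<le> dual_value r \<nu>"
    using dual_value_ge[OF bounded \<open>r \<in> S\<close> \<open>0 \<le> \<nu>\<close>, of 0] by simp
  obtain x where x: "is_lagrangian_maximizer r \<nu> x"
    using lagrangian_maximizer_exists[OF bounded \<open>r \<in> S\<close> \<open>0 \<le> \<nu>\<close>] .
  note x_act = lagrangian_maximizer_actions[OF x]
  have "0 \<le> \<nu> \<bullet> consumption r x"
    using request_boundsD(3)[OF bounded \<open>r \<in> S\<close> x_act] \<open>0 \<le> \<nu>\<close>
    by (intro inner_nonneg_orthant) (simp_all add: nonneg_vec_iff)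
  then show "dual_value r \<nu> \<le> fbar"
    using request_boundsD(2)[OF bounded \<open>r \<in> S\<close> x_act] by (simp add: dual_value_eq[OF x])
qed

text \<open>Always playing \<open>0\<close> is feasible, so the supremum runs over a nonempty set.
  The last bound is weak duality: pricing the budget at \<nu> decouples the time steps.\<close>

lemma opt_value_bounds:
  assumes bounded: "bounded_requests fbar bbar S"
    and \<gamma>: "\<And>t. t \<in> {1..T} \<Longrightarrow> \<gamma> t \<in> S \<and> valid_request (\<gamma> t)" and \<rho>: "0 \<le> \<rho>"
  shows "0 \<le> opt_value T \<rho> \<gamma>" "opt_value T \<rho> \<gamma> \<le> real T * fbar"
    "\<And>\<nu>. 0 \<le> \<nu> \<Longrightarrow> opt_value T \<rho> \<gamma> \<le> (\<Sum>t=1..T. dual_value (\<gamma> t) \<nu> + \<nu> \<bullet> \<rho>)"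
proof -
  define F where "F = {\<Sum>t=1..T. reward (\<gamma> t) (x t) | x.
    (\<forall>t\<in>{1..T}. x t \<in> actions (\<gamma> t)) \<and>
    (\<Sum>t=1..T. consumption (\<gamma> t) (x t)) \<le> real T *\<^sub>R \<rho>}"
  have opt: "opt_value T \<rho> \<gamma> = Sup F" by (simp add: opt_value_def F_def)
  have zero: "0 \<in> actions (\<gamma> t)" "consumption (\<gamma> t) 0 = 0" "0 \<le> reward (\<gamma> t) 0"
    if "t \<in> {1..T}" for t
    using \<gamma>[OF that] by (auto simp: valid_request_def)
  have "(\<Sum>t=1..T. consumption (\<gamma> t) 0) \<le> real T *\<^sub>R \<rho>"
    using zero(2) \<rho> by (simp add: less_eq_vec_def)
  then have F0: "(\<Sum>t=1..T. reward (\<gamma> t) 0) \<in> F"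
    unfolding F_def using zero(1) by (auto intro!: exI[of _ "\<lambda>t. 0"])
  have upper: "y \<le> real T * fbar" if "y \<in> F" for y
  proof -
    obtain x where x: "\<And>t. t \<in> {1..T} \<Longrightarrow> x t \<in> actions (\<gamma> t)" and y: "y = (\<Sum>t=1..T. reward (\<gamma> t) (x t))"
      using \<open>y \<in> F\<close> unfolding F_def by blast
    have "y \<le> (\<Sum>t=1..T. fbar)"
      unfolding y using x \<gamma> by (intro sum_mono request_boundsD(2)[OF bounded]) auto
    then show ?thesis by simp
  qed
  then have bdd: "bdd_above F" by (meson bdd_aboveI)
  show "0 \<le> opt_value T \<rho> \<gamma>"
    unfolding opt by (rule order_trans[OF sum_nonneg cSup_upper[OF F0 bdd]]) (rule zero(3))
  show "opt_value T \<rho> \<gamma> \<le> real T * fbar"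
    unfolding opt using F0 by (intro cSup_least upper) auto
  show "opt_value T \<rho> \<gamma> \<le> (\<Sum>t=1..T. dual_value (\<gamma> t) \<nu> + \<nu> \<bullet> \<rho>)" if \<nu>: "0 \<le> \<nu>" for \<nu>
    unfolding opt
  proof (rule cSup_least)
    show "F \<noteq> {}" using F0 by auto
    fix y assume "y \<in> F"
    then obtain x where x: "\<And>t. t \<in> {1..T} \<Longrightarrow> x t \<in> actions (\<gamma> t)"
      and y: "y = (\<Sum>t=1..T. reward (\<gamma> t) (x t))"
      and budget: "(\<Sum>t=1..T. consumption (\<gamma> t) (x t)) \<le> real T *\<^sub>R \<rho>"
      unfolding F_def by blast
    have "0 \<le> \<nu> \<bullet> (real T *\<^sub>R \<rho> - (\<Sum>t=1..T. consumption (\<gamma> t) (x t)))"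
      using budget by (intro inner_nonneg_orthant[OF \<nu>]) (simp add: less_eq_vec_def)
    then have "(\<Sum>t=1..T. \<nu> \<bullet> consumption (\<gamma> t) (x t)) \<le> real T * (\<nu> \<bullet> \<rho>)"
      by (simp add: inner_diff_right inner_sum_right)
    moreover have "y - (\<Sum>t=1..T. \<nu> \<bullet> consumption (\<gamma> t) (x t)) \<le> (\<Sum>t=1..T. dual_value (\<gamma> t) \<nu>)"
      unfolding y sum_subtractf[symmetric]
      using x \<gamma> by (intro sum_mono dual_value_ge[OF bounded _ \<nu>]) auto
    ultimately show "y \<le> (\<Sum>t=1..T. dual_value (\<gamma> t) \<nu> + \<nu> \<bullet> \<rho>)"
      by (simp add: sum.distrib)
  qed
qed

lemma mirror_descent_run_actions:
  assumes "mirror_descent_run T \<rho> h \<eta> \<mu>1 \<gamma> xt x B \<mu>" "t \<in> {1..T}" "valid_request (\<gamma> t)"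
  shows "x t \<in> actions (\<gamma> t)"
proof -
  have "is_lagrangian_maximizer (\<gamma> t) (\<mu> t) (xt t)"
    "x t = (if consumption (\<gamma> t) (xt t) \<le> B t then xt t else 0)"
    using assms(1,2) unfolding mirror_descent_run_def by blast+
  then show ?thesis
    using assms(3) lagrangian_maximizer_actions by (auto simp: valid_request_def)
qed

section \<open>Pathwise regret of dual mirror descent\<close>

text \<open>The step size is positive here; step size 0 is settled in the theorem. Differentiability
  at \<open>\<mu>1\<close> is an assumption because an essentially smooth \<open>h\<close>
  guarantees it only in the interior.\<close>

locale dual_mirror_descent_run =
  fixes S :: "('d::finite, 'm::finite) request set"
    and \<rho> \<mu>1 :: "real ^ 'm"
    and h :: "real ^ 'm \<Rightarrow> real"
    and \<sigma> \<eta> fbar bbar :: real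
    and T :: nat
    and xt x :: "(nat \<Rightarrow> ('d, 'm) request) \<Rightarrow> nat \<Rightarrow> real ^ 'd"
    and B \<mu> :: "(nat \<Rightarrow> ('d, 'm) request) \<Rightarrow> nat \<Rightarrow> real ^ 'm"
  assumes \<rho>_pos: "\<And>j. 0 < \<rho> $ j"
    and valid: "\<And>r. r \<in> S \<Longrightarrow> valid_request r"
    and bounded: "bounded_requests fbar bbar S"
    and ref: "reference_function \<sigma> h"
    and \<eta>_pos: "0 < \<eta>"
    and \<mu>1_nonneg: "0 \<le> \<mu>1"
    and \<mu>1_diff: "h differentiable (at \<mu>1 within {0..})"
    and dmd: "dual_mirror_descent T \<rho> h \<eta> \<mu>1 S xt x B \<mu>"
begin

abbreviation paths :: "(nat \<Rightarrow> ('d, 'm) request) set" where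
  "paths \<equiv> {1..T} \<rightarrow>\<^sub>E S"

definition use :: "(nat \<Rightarrow> ('d, 'm) request) \<Rightarrow> nat \<Rightarrow> real ^ 'm" where
  "use \<gamma> t = consumption (\<gamma> t) (xt \<gamma> t)"

definition \<rho>max :: real where
  "\<rho>max = Max (range (\<lambda>j. \<rho> $ j))"

definition \<rho>min :: real where
  "\<rho>min = Min (range (\<lambda>j. \<rho> $ j))"

definition regret_bound :: real where
  "regret_bound = fbar * bbar / \<rho>min + (bbar + \<rho>max)\<^sup>2 / (2 * \<sigma>) * \<eta> * real T
    + Max ((\<lambda>v. bregman h v \<mu>1) ` insert 0 (range (\<lambda>j. axis j (fbar / \<rho> $ j)))) / \<eta>"

text \<open>
  Under \<open>slack \<gamma> t\<close> even a request of maximal consumption is affordable at time \<open>t\<close>.  Unlike the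
  stopping time it encodes, it refers only to tentative actions before time \<open>t\<close>, which makes
  measurability and dependence on the past immediate.
\<close>

definition slack :: "(nat \<Rightarrow> ('d, 'm) request) \<Rightarrow> nat \<Rightarrow> bool" where
  "slack \<gamma> t \<longleftrightarrow> (\<forall>j. bbar + (\<Sum>s=1..<t. use \<gamma> s $ j) \<le> real T * \<rho> $ j)"

section \<open>Signs of the constants\<close>

lemma \<sigma>_pos: "0 < \<sigma>"
  using ref by (simp add: reference_function_def)

lemma fbar_nonneg: "0 \<le> fbar" and bbar_nonneg: "0 \<le> bbar"
  using bounded by (auto simp: bounded_requests_def)

lemma \<rho>max_ge: "\<rho> $ j \<le> \<rho>max"
  by (simp add: \<rho>max_def)

lemma \<rho>min_le: "\<rho>min \<le> \<rho> $ j"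
  by (simp add: \<rho>min_def)

lemma \<rho>min_pos: "0 < \<rho>min"
  using \<rho>_pos by (simp add: \<rho>min_def)

lemma \<rho>_nonneg: "0 \<le> \<rho>"
  using \<rho>_pos by (simp add: nonneg_vec_iff order.strict_implies_order)

lemma bregman_le_Max:
  assumes "v \<in> insert 0 (range (\<lambda>j. axis j (fbar / \<rho> $ j)))"
  shows "bregman h v \<mu>1 \<le> Max ((\<lambda>v. bregman h v \<mu>1) ` insert 0 (range (\<lambda>j. axis j (fbar / \<rho> $ j))))"
  using assms by (intro Max_ge) auto

text \<open>Covers the default value 0 of an integral whose integrand is not integrable.\<close>

lemma regret_bound_nonneg: "0 \<le> regret_bound"
proof -
  have "0 \<le> bregman h 0 \<mu>1" by (rule bregman_nonneg[OF ref _ \<mu>1_nonneg \<mu>1_diff]) simp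
  also have "\<dots> \<le> Max ((\<lambda>v. bregman h v \<mu>1) ` insert 0 (range (\<lambda>j. axis j (fbar / \<rho> $ j))))"
    by (rule bregman_le_Max) simp
  finally show ?thesis
    using fbar_nonneg bbar_nonneg \<rho>min_pos \<sigma>_pos \<eta>_pos by (simp add: regret_bound_def)
qed

section \<open>Analysis of one fixed request sequence\<close>

context
  fixes \<gamma> assumes \<gamma>: "\<gamma> \<in> paths"
begin

lemma run:
  shows "B \<gamma> 1 = real T *\<^sub>R \<rho>" "\<mu> \<gamma> 1 = \<mu>1"
    and "t \<in> {1..T} \<Longrightarrow> is_lagrangian_maximizer (\<gamma> t) (\<mu> \<gamma> t) (xt \<gamma> t)"
    and "t \<in> {1..T} \<Longrightarrow> x \<gamma> t = (if use \<gamma> t \<le> B \<gamma> t then xt \<gamma> t else 0)"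
    and "t \<in> {1..T} \<Longrightarrow> B \<gamma> (t + 1) = B \<gamma> t - consumption (\<gamma> t) (x \<gamma> t)"
    and "t \<in> {1..T} \<Longrightarrow> is_mirror_step h \<eta> (\<rho> - use \<gamma> t) (\<mu> \<gamma> t) (\<mu> \<gamma> (t + 1))"
proof -
  have "mirror_descent_run T \<rho> h \<eta> \<mu>1 \<gamma> (xt \<gamma>) (x \<gamma>) (B \<gamma>) (\<mu> \<gamma>)"
    using dmd \<gamma> unfolding dual_mirror_descent_def by blast
  note R = this[unfolded mirror_descent_run_def]
  show "B \<gamma> 1 = real T *\<^sub>R \<rho>" "\<mu> \<gamma> 1 = \<mu>1" using R by blast+
  assume t: "t \<in> {1..T}"
  show "is_lagrangian_maximizer (\<gamma> t) (\<mu> \<gamma> t) (xt \<gamma> t)"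
    "x \<gamma> t = (if use \<gamma> t \<le> B \<gamma> t then xt \<gamma> t else 0)"
    "B \<gamma> (t + 1) = B \<gamma> t - consumption (\<gamma> t) (x \<gamma> t)"
    "is_mirror_step h \<eta> (\<rho> - use \<gamma> t) (\<mu> \<gamma> t) (\<mu> \<gamma> (t + 1))"
    unfolding use_def using R t by blast+
qed

lemma path_in: "t \<in> {1..T} \<Longrightarrow> \<gamma> t \<in> S"
  using \<gamma> by auto

lemma xt_actions: "t \<in> {1..T} \<Longrightarrow> xt \<gamma> t \<in> actions (\<gamma> t)"
  by (rule lagrangian_maximizer_actions[OF run(3)])

lemma x_actions: "t \<in> {1..T} \<Longrightarrow> x \<gamma> t \<in> actions (\<gamma> t)"
  using run(4) xt_actions valid[OF path_in] by (auto simp: valid_request_def)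

lemma use_bounds:
  assumes "t \<in> {1..T}"
  shows "0 \<le> use \<gamma> t $ j" "use \<gamma> t $ j \<le> bbar"
  unfolding use_def
  using request_boundsD[OF bounded path_in xt_actions] assms by auto

lemma gradient_bound:
  assumes "t \<in> {1..T}"
  shows "\<bar>(\<rho> - use \<gamma> t) $ j\<bar> \<le> bbar + \<rho>max"
  using use_bounds[OF assms, of j] \<rho>_pos[of j] \<rho>max_ge[of j] by simp

text \<open>The range reaches \<open>T + 1\<close> because the telescoped regret ends with a
  divergence at \<open>\<mu> \<gamma> (n + 1)\<close> for \<open>n \<le> T\<close>.\<close>

lemma \<mu>_regular:
  assumes "t \<in> {1..T + 1}"
  shows "0 \<le> \<mu> \<gamma> t \<and> h differentiable (at (\<mu> \<gamma> t) within {0..})"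
proof (cases "t = 1")
  case True
  then show ?thesis using run(2) \<mu>1_nonneg \<mu>1_diff by simp
next
  case False
  with assms have "t - 1 \<in> {1..T}" "t - 1 + 1 = t" by auto
  with run(6)[of "t - 1"] have "is_mirror_step h \<eta> (\<rho> - use \<gamma> (t - 1)) (\<mu> \<gamma> (t - 1)) (\<mu> \<gamma> t)"
    by simp
  then show ?thesis using mirror_step_nonneg mirror_step_differentiable[OF ref _ \<eta>_pos] by blast
qed

text \<open>Each mirror step moves the price by a bounded l1 distance, so its \<rho>-weighted size
  grows at most linearly. This makes the Lagrangian bounded and hence integrable.\<close>

lemma price_bound:
  assumes "t \<in> {1..T}"
  shows "\<mu> \<gamma> t \<bullet> \<rho> \<le> \<mu>1 \<bullet> \<rho> + real t * (\<rho>max * (2 * \<eta> * (bbar + \<rho>max) / \<sigma>))"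
  using assms
proof (induction t)
  case (Suc t)
  let ?K = "\<rho>max * (2 * \<eta> * (bbar + \<rho>max) / \<sigma>)"
  have \<rho>max: "0 < \<rho>max" using \<rho>_pos \<rho>max_ge less_le_trans by blast
  then have K: "0 \<le> ?K" using \<eta>_pos \<sigma>_pos bbar_nonneg by (simp add: less_imp_le)
  show ?case
  proof (cases "t = 0")
    case True
    then show ?thesis using run(2) K by simp
  next
    case False
    then have t: "t \<in> {1..T}" using Suc.prems by auto
    have "\<rho> \<bullet> (\<mu> \<gamma> (t + 1) - \<mu> \<gamma> t) \<le> \<rho>max * l1_norm (\<mu> \<gamma> (t + 1) - \<mu> \<gamma> t)"
      using \<rho>_pos \<rho>max_ge by (intro inner_le_l1_norm) (simp add: abs_of_pos)
    also have "\<dots> \<le> ?K"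
      using \<mu>_regular[of t] t \<rho>max
      by (intro mult_left_mono mirror_step_l1_bound[OF ref run(6)[OF t] \<eta>_pos] gradient_bound[OF t]) auto
    finally have "\<mu> \<gamma> (Suc t) \<bullet> \<rho> \<le> \<mu> \<gamma> t \<bullet> \<rho> + ?K"
      by (simp add: inner_diff_right inner_commute)
    moreover have "real (Suc t) * ?K = real t * ?K + ?K" by (simp only: of_nat_Suc distrib_right mult_1 add.commute)
    ultimately show ?thesis using Suc.IH[OF t] by linarith
  qed
qed simp

lemma slack_antimono:
  assumes "slack \<gamma> t" "s \<le> t" "t \<le> T + 1"
  shows "slack \<gamma> s"
proof -
  have "(\<Sum>r=1..<s. use \<gamma> r $ j) \<le> (\<Sum>r=1..<t. use \<gamma> r $ j)" for j
    using assms by (intro sum_mono2 use_bounds(1)) auto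
  then show ?thesis using assms(1) unfolding slack_def by (meson add_left_mono order_trans)
qed

text \<open>The budget formula is a hypothesis because its own inductive proof invokes this lemma at
  the preceding time.\<close>

lemma affordable_if_slack:
  assumes "slack \<gamma> t" "t \<in> {1..T}" and B: "B \<gamma> t = real T *\<^sub>R \<rho> - (\<Sum>s=1..<t. use \<gamma> s)"
  shows "x \<gamma> t = xt \<gamma> t"
proof -
  have "use \<gamma> t $ j \<le> B \<gamma> t $ j" for j
  proof -
    have "bbar + (\<Sum>s=1..<t. use \<gamma> s $ j) \<le> real T * \<rho> $ j"
      using assms(1) by (simp add: slack_def)
    then show ?thesis using use_bounds(2)[OF assms(2), of j] by (simp add: B)
  qed
  then have "use \<gamma> t \<le> B \<gamma> t" by (simp add: less_eq_vec_def)
  then show ?thesis using run(4)[OF assms(2)] by simp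
qed

text \<open>Slack at \<open>t\<close> implies slack at all earlier times, so no tentative action was
  rejected before \<open>t\<close> and actual consumption equals tentative consumption.\<close>

lemma budget_if_slack:
  assumes "slack \<gamma> t" "t \<in> {1..T}"
  shows "B \<gamma> t = real T *\<^sub>R \<rho> - (\<Sum>s=1..<t. use \<gamma> s)"
  using assms
proof (induction t)
  case (Suc t)
  show ?case
  proof (cases "t = 0")
    case True
    then show ?thesis using run(1) by simp
  next
    case False
    then have t: "t \<in> {1..T}" using Suc.prems by auto
    have slack: "slack \<gamma> t" using slack_antimono[OF Suc.prems(1)] t by simp
    note IH = Suc.IH[OF slack t]
    have "B \<gamma> (t + 1) = B \<gamma> t - use \<gamma> t"
      using run(5)[OF t] affordable_if_slack[OF slack t IH] by (simp add: use_def)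
    then show ?thesis using False by (simp add: IH)
  qed
qed simp

lemma total_reward_ge:
  "(\<Sum>t=1..T. if slack \<gamma> t then reward (\<gamma> t) (xt \<gamma> t) else 0) \<le> total_reward T \<gamma> (x \<gamma>)"
  unfolding total_reward_def
proof (rule sum_mono)
  fix t assume t: "t \<in> {1..T}"
  show "(if slack \<gamma> t then reward (\<gamma> t) (xt \<gamma> t) else 0) \<le> reward (\<gamma> t) (x \<gamma> t)"
    using affordable_if_slack[OF _ t] budget_if_slack[OF _ t]
      request_boundsD(1)[OF bounded path_in[OF t] x_actions[OF t]] by auto
qed

text \<open>In the sum of the per-step inequalities the divergences from the comparator
  telescope.\<close>

lemma dual_regret:
  assumes "n \<le> T" "0 \<le> u"
  shows "(\<Sum>t=1..n. (\<rho> - use \<gamma> t) \<bullet> (\<mu> \<gamma> t - u))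
    \<le> real n * (\<eta> * (bbar + \<rho>max)\<^sup>2 / (2 * \<sigma>)) + (bregman h u \<mu>1 - bregman h u (\<mu> \<gamma> (n + 1))) / \<eta>"
  using assms(1)
proof (induction n)
  case 0
  then show ?case using run(2) by simp
next
  case (Suc n)
  then have t: "Suc n \<in> {1..T}" by auto
  have "(\<rho> - use \<gamma> (Suc n)) \<bullet> (\<mu> \<gamma> (Suc n) - u) \<le> \<eta> * (bbar + \<rho>max)\<^sup>2 / (2 * \<sigma>)
      + (bregman h u (\<mu> \<gamma> (Suc n)) - bregman h u (\<mu> \<gamma> (Suc n + 1))) / \<eta>"
    using \<mu>_regular[of "Suc n"] t
    by (intro mirror_step_regret[OF ref run(6)[OF t] \<eta>_pos] gradient_bound[OF t] assms(2)) auto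
  moreover have "real (Suc n) * (\<eta> * (bbar + \<rho>max)\<^sup>2 / (2 * \<sigma>))
      = \<eta> * (bbar + \<rho>max)\<^sup>2 / (2 * \<sigma>) + real n * (\<eta> * (bbar + \<rho>max)\<^sup>2 / (2 * \<sigma>))"
    by (simp only: of_nat_Suc distrib_right mult_1 add.commute)
  moreover have "(\<Sum>t=1..n. (\<rho> - use \<gamma> t) \<bullet> (\<mu> \<gamma> t - u)) \<le> real n * (\<eta> * (bbar + \<rho>max)\<^sup>2 / (2 * \<sigma>))
      + (bregman h u \<mu>1 - bregman h u (\<mu> \<gamma> (Suc n))) / \<eta>"
    using Suc by simp
  ultimately show ?case by (simp add: diff_divide_distrib)
qed

text \<open>Slack is never regained, so the slack times form an initial segment. If it ends early,
  at time \<open>n\<close>, some resource \<open>j\<close> violates the condition at time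
  \<open>n + 1\<close>.\<close>

lemma slack_prefix:
  obtains "\<And>t. t \<in> {1..T} \<Longrightarrow> slack \<gamma> t"
  | n j where "n < T" "\<And>t. t \<in> {1..T} \<Longrightarrow> slack \<gamma> t \<longleftrightarrow> t \<le> n"
      "real T * \<rho> $ j < bbar + (\<Sum>s=1..n. use \<gamma> s $ j)"
proof (cases "\<forall>t\<in>{1..T}. slack \<gamma> t")
  case False
  define t0 where "t0 = (LEAST t. t \<in> {1..T} \<and> \<not> slack \<gamma> t)"
  have t0: "t0 \<in> {1..T}" "\<not> slack \<gamma> t0"
    using False LeastI_ex[of "\<lambda>t. t \<in> {1..T} \<and> \<not> slack \<gamma> t"] unfolding t0_def by blast+
  have least: "slack \<gamma> t" if "t \<in> {1..T}" "t < t0" for t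
    using not_less_Least[OF that(2)[unfolded t0_def]] that(1) by blast
  have "slack \<gamma> t \<longleftrightarrow> t \<le> t0 - 1" if "t \<in> {1..T}" for t
    using least[OF that] slack_antimono[of t t0] t0 that by fastforce
  moreover obtain j where "real T * \<rho> $ j < bbar + (\<Sum>s=1..<t0. use \<gamma> s $ j)"
    using t0(2) by (auto simp: slack_def not_le)
  moreover have "{1..<t0} = {1..t0 - 1}" using t0(1) by auto
  moreover have "t0 - 1 < T" using t0(1) by auto
  ultimately show ?thesis using that(2)[of "t0 - 1" j] by simp
qed (use that in blast)

text \<open>
  The comparator is \<open>0\<close> if the resources last until the end.  If resource \<open>j\<close> runs out after \<open>n\<close>
  steps, it is \<open>(fbar / \<rho> $ j) e\<^sub>j\<close>, which pays for the reward lost in the remaining steps.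
\<close>

lemma pathwise_bound:
  "(\<Sum>t=1..T. if slack \<gamma> t then (\<rho> - use \<gamma> t) \<bullet> \<mu> \<gamma> t else fbar) \<le> regret_bound"
proof -
  define C where "C = \<eta> * (bbar + \<rho>max)\<^sup>2 / (2 * \<sigma>)"
  define V where "V = Max ((\<lambda>v. bregman h v \<mu>1) ` insert 0 (range (\<lambda>j. axis j (fbar / \<rho> $ j))))"
  have C: "0 \<le> C" using \<eta>_pos \<sigma>_pos by (simp add: C_def)
  have C1: "0 \<le> fbar * bbar / \<rho>min" using fbar_nonneg bbar_nonneg \<rho>min_pos by simp
  have bound: "regret_bound = fbar * bbar / \<rho>min + real T * C + V / \<eta>"
    by (simp add: regret_bound_def C_def V_def)
  \<comment> \<open>The final divergence is nonnegative and is dropped; the error of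
    \<open>n\<close> steps is enlarged to that of \<open>T\<close> steps.\<close>
  have regret: "(\<Sum>t=1..n. (\<rho> - use \<gamma> t) \<bullet> (\<mu> \<gamma> t - u)) \<le> real T * C + V / \<eta>"
    if "n \<le> T" "0 \<le> u" "u \<in> insert 0 (range (\<lambda>j. axis j (fbar / \<rho> $ j)))" for n u
  proof -
    have "0 \<le> bregman h u (\<mu> \<gamma> (n + 1))"
      using \<mu>_regular[of "n + 1"] that by (intro bregman_nonneg[OF ref]) auto
    then have "(bregman h u \<mu>1 - bregman h u (\<mu> \<gamma> (n + 1))) / \<eta> \<le> V / \<eta>"
      using bregman_le_Max[OF that(3)] \<eta>_pos by (intro divide_right_mono) (auto simp: V_def)
    moreover have "real n * C \<le> real T * C" using that C by (intro mult_right_mono) auto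
    ultimately show ?thesis using dual_regret[OF that(1,2)] by (simp add: C_def)
  qed
  show ?thesis
  proof (rule slack_prefix)
    assume "\<And>t. t \<in> {1..T} \<Longrightarrow> slack \<gamma> t"
    then have "(\<Sum>t=1..T. if slack \<gamma> t then (\<rho> - use \<gamma> t) \<bullet> \<mu> \<gamma> t else fbar)
        = (\<Sum>t=1..T. (\<rho> - use \<gamma> t) \<bullet> (\<mu> \<gamma> t - 0))" by simp
    with regret[of T 0] C1 show ?thesis by (simp add: bound)
  next
    fix n j
    assume "n < T" and slack: "\<And>t. t \<in> {1..T} \<Longrightarrow> slack \<gamma> t \<longleftrightarrow> t \<le> n"
      and depleted: "real T * \<rho> $ j < bbar + (\<Sum>s=1..n. use \<gamma> s $ j)"
    define u where "u = axis j (fbar / \<rho> $ j)"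
    have u: "0 \<le> u" using fbar_nonneg \<rho>_pos[of j] by (simp add: u_def nonneg_vec_iff axis_def)
    have "(\<Sum>t=1..T. if slack \<gamma> t then (\<rho> - use \<gamma> t) \<bullet> \<mu> \<gamma> t else fbar)
        = (\<Sum>t=1..T. if t \<le> n then (\<rho> - use \<gamma> t) \<bullet> \<mu> \<gamma> t else fbar)"
      by (rule sum.cong) (auto simp: slack)
    also have "\<dots> = (\<Sum>t=1..n. (\<rho> - use \<gamma> t) \<bullet> \<mu> \<gamma> t) + (\<Sum>t=n+1..T. fbar)"
    proof -
      have "{1..T} = {1..n} \<union> {n+1..T}" using \<open>n < T\<close> by auto
      then show ?thesis by (simp add: sum.union_disjoint)
    qed
    also have "\<dots> = (\<Sum>t=1..n. (\<rho> - use \<gamma> t) \<bullet> (\<mu> \<gamma> t - u)) + (\<Sum>t=1..n. (\<rho> - use \<gamma> t) \<bullet> u)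
        + (real T - real n) * fbar"
      using \<open>n < T\<close> by (simp add: inner_diff_right sum_subtractf)
    \<comment> \<open>Depletion says that the use of \<open>j\<close> exceeds
      \<open>real T * \<rho> $ j - bbar\<close>. Weighted by \<open>fbar / \<rho> $ j\<close>, this
      yields exactly \<open>fbar\<close> for each of the \<open>T - n\<close> remaining steps, up to
      the error with \<open>bbar\<close>.\<close>
    also have "(\<Sum>t=1..n. (\<rho> - use \<gamma> t) \<bullet> u) \<le> fbar * bbar / \<rho>min - (real T - real n) * fbar"
    proof -
      have "(\<Sum>t=1..n. (\<rho> - use \<gamma> t) \<bullet> u)
          = (real n * \<rho> $ j - (\<Sum>s=1..n. use \<gamma> s $ j)) * (fbar / \<rho> $ j)"
        by (simp add: u_def inner_axis sum_subtractf flip: sum_distrib_right sum_divide_distrib)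
      also have "\<dots> \<le> (bbar - (real T - real n) * \<rho> $ j) * (fbar / \<rho> $ j)"
        using depleted fbar_nonneg \<rho>_pos[of j]
        by (intro mult_right_mono) (auto simp: algebra_simps)
      also have "\<dots> = fbar * bbar / \<rho> $ j - (real T - real n) * fbar"
        using \<rho>_pos[of j] by (simp add: field_simps)
      also have "fbar * bbar / \<rho> $ j \<le> fbar * bbar / \<rho>min"
        using fbar_nonneg bbar_nonneg \<rho>min_pos \<rho>min_le[of j] by (intro divide_left_mono) auto
      finally show ?thesis by simp
    qed
    finally show ?thesis using regret[OF _ u, of n] \<open>n < T\<close> by (simp add: bound u_def)
  qed
qed

end

section \<open>Dependence on past requests only\<close>

lemma nonanticipative:
  assumes \<gamma>: "\<gamma> \<in> paths" "\<gamma>' \<in> paths" and t: "t \<in> {1..T}" and "\<And>s. s \<in> {1..t} \<Longrightarrow> \<gamma> s = \<gamma>' s"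
  shows "use \<gamma> t = use \<gamma>' t"
proof -
  have "xt \<gamma> t = xt \<gamma>' t"
    using dmd assms unfolding dual_mirror_descent_def by blast
  moreover have "\<gamma> t = \<gamma>' t" using assms(4)[of t] t by simp
  ultimately show ?thesis by (simp add: use_def)
qed

lemma slack_predictable:
  assumes \<gamma>: "\<gamma> \<in> paths" "\<gamma>' \<in> paths" and "t \<in> {1..T}" and past: "\<And>s. s \<in> {1..<t} \<Longrightarrow> \<gamma> s = \<gamma>' s"
  shows "slack \<gamma> t \<longleftrightarrow> slack \<gamma>' t"
proof -
  have "use \<gamma> s = use \<gamma>' s" if "s \<in> {1..<t}" for s
    using assms that by (intro nonanticipative[OF \<gamma>]) auto
  then show ?thesis by (simp add: slack_def)
qed

text \<open>By induction: the next price is the unique mirror step determined by the current price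
  and the current use, which sees no later request.\<close>

lemma \<mu>_predictable:
  assumes \<gamma>: "\<gamma> \<in> paths" "\<gamma>' \<in> paths" and "t \<in> {1..T}" and "\<And>s. s \<in> {1..<t} \<Longrightarrow> \<gamma> s = \<gamma>' s"
  shows "\<mu> \<gamma> t = \<mu> \<gamma>' t"
  using assms(3,4)
proof (induction t)
  case (Suc t)
  show ?case
  proof (cases "t = 0")
    case True
    then show ?thesis using run(2)[OF \<gamma>(1)] run(2)[OF \<gamma>(2)] by simp
  next
    case False
    then have t: "t \<in> {1..T}" using Suc.prems by auto
    have "\<mu> \<gamma> t = \<mu> \<gamma>' t" using Suc t by simp
    moreover have "use \<gamma> t = use \<gamma>' t" using Suc.prems t by (intro nonanticipative[OF \<gamma>]) auto
    ultimately have "is_mirror_step h \<eta> (\<rho> - use \<gamma> t) (\<mu> \<gamma> t) (\<mu> \<gamma>' (t + 1))"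
      using run(6)[OF \<gamma>(2) t] by simp
    then show ?thesis
      using mirror_step_unique[OF ref run(6)[OF \<gamma>(1) t] _ \<eta>_pos] by simp
  qed
qed simp

end

section \<open>Requests drawn independently\<close>

lemma measurable_PiM_cong:
  assumes "sets P = sets M"
  shows "measurable (\<Pi>\<^sub>M t\<in>I. P) N = measurable (\<Pi>\<^sub>M t\<in>I. M) N"
  by (intro measurable_cong_sets sets_PiM_cong) (simp_all add: assms)

text \<open>Every distribution in \<open>prob_algebra M\<close> has the measurable sets of
  \<open>M\<close>, so one measurability hypothesis serves all of them.\<close>

lemma measurable_execution_cong:
  assumes "sets P = sets M"
  shows "measurable_execution T \<rho> P xt \<mu> \<longleftrightarrow> measurable_execution T \<rho> M xt \<mu>"
  by (simp only: measurable_execution_def measurable_PiM_cong[OF assms])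

locale iid_dual_mirror_descent_run =
  dual_mirror_descent_run "space P" \<rho> \<mu>1 h \<sigma> \<eta> fbar bbar T xt x B \<mu> + prob_space P
  for P :: "('d::finite, 'm::finite) request measure"
    and \<rho> \<mu>1 :: "real ^ 'm"
    and h :: "real ^ 'm \<Rightarrow> real"
    and \<sigma> \<eta> fbar bbar :: real
    and T :: nat
    and xt x :: "(nat \<Rightarrow> ('d, 'm) request) \<Rightarrow> nat \<Rightarrow> real ^ 'd"
    and B \<mu> :: "(nat \<Rightarrow> ('d, 'm) request) \<Rightarrow> nat \<Rightarrow> real ^ 'm" +
  assumes T_pos: "1 \<le> T"
    and meas: "measurable_execution T \<rho> P xt \<mu>"
begin

definition \<Omega> :: "(nat \<Rightarrow> ('d, 'm) request) measure" where
  "\<Omega> = (\<Pi>\<^sub>M t\<in>{1..T}. P)"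

definition lagrangian :: "(nat \<Rightarrow> ('d, 'm) request) \<Rightarrow> nat \<Rightarrow> real" where
  "lagrangian \<gamma> t = reward (\<gamma> t) (xt \<gamma> t) + (\<rho> - use \<gamma> t) \<bullet> \<mu> \<gamma> t"

definition mean_opt :: real where
  "mean_opt = (\<integral>\<gamma>. opt_value T \<rho> \<gamma> \<partial>\<Omega>) / real T"

sublocale \<Omega>: prob_space \<Omega>
  unfolding \<Omega>_def by (intro prob_space_PiM prob_space_axioms)

section \<open>Measurability along the run\<close>

lemma space_\<Omega>: "space \<Omega> = paths"
  by (simp add: \<Omega>_def space_PiM)

lemma measurable_opt [measurable]: "opt_value T \<rho> \<in> borel_measurable \<Omega>"
  using meas unfolding measurable_execution_def \<Omega>_def by blast

lemma measurable_reward [measurable]: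
  "t \<in> {1..T} \<Longrightarrow> (\<lambda>\<gamma>. reward (\<gamma> t) (xt \<gamma> t)) \<in> borel_measurable \<Omega>"
  using meas unfolding measurable_execution_def \<Omega>_def by blast

lemma measurable_use [measurable]:
  "t \<in> {1..T} \<Longrightarrow> (\<lambda>\<gamma>. use \<gamma> t) \<in> borel_measurable \<Omega>"
  using meas unfolding measurable_execution_def use_def \<Omega>_def by blast

lemma measurable_\<mu> [measurable]:
  "t \<in> {1..T} \<Longrightarrow> (\<lambda>\<gamma>. \<mu> \<gamma> t) \<in> borel_measurable \<Omega>"
  using meas unfolding measurable_execution_def \<Omega>_def by blast

lemma measurable_slack:
  assumes "t \<in> {1..T}"
  shows "{\<gamma>\<in>space \<Omega>. slack \<gamma> t} \<in> sets \<Omega>"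
proof -
  \<comment> \<open>Coordinates are written as inner products to inherit measurability from the
    vector.\<close>
  have "(\<lambda>\<gamma>. use \<gamma> s \<bullet> axis j 1) \<in> borel_measurable \<Omega>" if "s \<in> {1..<t}" for s j
    using assms that by (intro borel_measurable_inner measurable_use) auto
  then have "(\<lambda>\<gamma>. use \<gamma> s $ j) \<in> borel_measurable \<Omega>" if "s \<in> {1..<t}" for s j
    using that by (simp add: inner_axis)
  then have "(\<lambda>\<gamma>. bbar + (\<Sum>s=1..<t. use \<gamma> s $ j)) \<in> borel_measurable \<Omega>" for j
    by (intro borel_measurable_add borel_measurable_sum) auto
  then have "{\<gamma>\<in>space \<Omega>. bbar + (\<Sum>s=1..<t. use \<gamma> s $ j) \<le> real T * \<rho> $ j} \<in> sets \<Omega>" for j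
    by (rule borel_measurable_le) simp
  then have "{\<gamma>\<in>space \<Omega>. \<forall>j\<in>UNIV. bbar + (\<Sum>s=1..<t. use \<gamma> s $ j) \<le> real T * \<rho> $ j} \<in> sets \<Omega>"
    by (intro sets.sets_Collect_finite_All) auto
  then show ?thesis by (simp add: slack_def)
qed

lemma measurable_if_slack:
  assumes "t \<in> {1..T}" "f \<in> borel_measurable \<Omega>"
  shows "(\<lambda>\<gamma>. if slack \<gamma> t then f \<gamma> else (0::real)) \<in> borel_measurable \<Omega>"
  using assms measurable_slack by (intro measurable_If) auto

lemma measurable_lagrangian:
  assumes "t \<in> {1..T}"
  shows "(\<lambda>\<gamma>. lagrangian \<gamma> t) \<in> borel_measurable \<Omega>"
  unfolding lagrangian_def
  using assms by (intro borel_measurable_add borel_measurable_inner borel_measurable_diff) auto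

text \<open>The tentative action attains the dual supremum, so the request at time \<open>t\<close>
  enters only through the dual function at a price fixed by the past.\<close>

lemma lagrangian_eq_dual_value:
  assumes "\<gamma> \<in> paths" "t \<in> {1..T}"
  shows "lagrangian \<gamma> t = dual_value (\<gamma> t) (\<mu> \<gamma> t) + \<mu> \<gamma> t \<bullet> \<rho>"
  using dual_value_eq[OF run(3)[OF assms]]
  by (simp add: lagrangian_def use_def inner_diff_left inner_diff_right inner_commute)

lemma lagrangian_bounds:
  assumes "\<gamma> \<in> paths" "t \<in> {1..T}"
  shows "0 \<le> lagrangian \<gamma> t"
    "lagrangian \<gamma> t \<le> fbar + (\<mu>1 \<bullet> \<rho> + real t * (\<rho>max * (2 * \<eta> * (bbar + \<rho>max) / \<sigma>)))"
proof -
  have \<mu>: "0 \<le> \<mu> \<gamma> t" using \<mu>_regular[OF assms(1)] assms(2) by auto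
  note dual = dual_value_bounds[OF bounded path_in[OF assms] valid[OF path_in[OF assms]] \<mu>]
  show "0 \<le> lagrangian \<gamma> t"
    using dual(1) inner_nonneg_orthant[OF \<mu> \<rho>_nonneg]
    by (simp add: lagrangian_eq_dual_value[OF assms])
  show "lagrangian \<gamma> t \<le> fbar + (\<mu>1 \<bullet> \<rho> + real t * (\<rho>max * (2 * \<eta> * (bbar + \<rho>max) / \<sigma>)))"
    unfolding lagrangian_eq_dual_value[OF assms]
    using dual(2) price_bound[OF assms] by (rule add_mono)
qed

section \<open>Weak duality in expectation\<close>

lemma opt_bounds:
  assumes "\<gamma> \<in> paths"
  shows "0 \<le> opt_value T \<rho> \<gamma>" "opt_value T \<rho> \<gamma> \<le> real T * fbar"
    "0 \<le> \<nu> \<Longrightarrow> opt_value T \<rho> \<gamma> \<le> (\<Sum>t=1..T. dual_value (\<gamma> t) \<nu> + \<nu> \<bullet> \<rho>)"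
  using opt_value_bounds[OF bounded _ \<rho>_nonneg, of T \<gamma>] path_in[OF assms] valid by blast+

lemma integrable_opt: "integrable \<Omega> (opt_value T \<rho>)"
  by (rule \<Omega>.integrable_const_bound[where B = "real T * fbar"])
    (auto simp: space_\<Omega> opt_bounds)

text \<open>Once slack is lost, a step's gap is 0 while it is charged
  \<open>fbar - mean_opt\<close>; this charge must be nonnegative.\<close>

lemma mean_opt_le: "mean_opt \<le> fbar"
proof -
  have "(\<integral>\<gamma>. opt_value T \<rho> \<gamma> \<partial>\<Omega>) \<le> (\<integral>\<gamma>. real T * fbar \<partial>\<Omega>)"
    using integrable_opt by (rule integral_mono) (auto simp: space_\<Omega> opt_bounds)
  then show ?thesis using T_pos by (simp add: mean_opt_def \<Omega>.prob_space pos_divide_le_eq mult.commute)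
qed

text \<open>Weak duality at a deterministic price, averaged: every coordinate has law
  \<open>P\<close>, so the \<open>T\<close> dual terms share one mean and division by
  \<open>T\<close> gives the bound.\<close>

lemma mean_opt_le_dual:
  assumes \<nu>: "0 \<le> \<nu>" and m: "(\<lambda>r. dual_value r \<nu>) \<in> borel_measurable P"
  shows "integrable P (\<lambda>r. dual_value r \<nu>)"
    "mean_opt \<le> (\<integral>r. dual_value r \<nu> \<partial>P) + \<nu> \<bullet> \<rho>"
proof -
  show int: "integrable P (\<lambda>r. dual_value r \<nu>)"
    using m dual_value_bounds[OF bounded _ valid \<nu>]
    by (intro integrable_const_bound[where B = fbar] AE_I2) auto
  have distr: "distr \<Omega> P (\<lambda>\<gamma>. \<gamma> t) = P" if "t \<in> {1..T}" for t
    using that unfolding \<Omega>_def by (intro distr_PiM_component prob_space_axioms)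
  have int_t: "integrable \<Omega> (\<lambda>\<gamma>. dual_value (\<gamma> t) \<nu>)"
    and eq_t: "(\<integral>\<gamma>. dual_value (\<gamma> t) \<nu> \<partial>\<Omega>) = (\<integral>r. dual_value r \<nu> \<partial>P)" if t: "t \<in> {1..T}" for t
  proof -
    have comp: "(\<lambda>\<gamma>. \<gamma> t) \<in> measurable \<Omega> P" using t unfolding \<Omega>_def by (rule measurable_component_singleton)
    show "integrable \<Omega> (\<lambda>\<gamma>. dual_value (\<gamma> t) \<nu>)"
      using integrable_distr[OF comp, of "\<lambda>r. dual_value r \<nu>"] int by (simp add: distr[OF t])
    show "(\<integral>\<gamma>. dual_value (\<gamma> t) \<nu> \<partial>\<Omega>) = (\<integral>r. dual_value r \<nu> \<partial>P)"
      using integral_distr[OF comp m] by (simp add: distr[OF t])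
  qed
  have "(\<integral>\<gamma>. opt_value T \<rho> \<gamma> \<partial>\<Omega>) \<le> (\<integral>\<gamma>. (\<Sum>t=1..T. dual_value (\<gamma> t) \<nu> + \<nu> \<bullet> \<rho>) \<partial>\<Omega>)"
  proof (rule integral_mono[OF integrable_opt])
    show "integrable \<Omega> (\<lambda>\<gamma>. \<Sum>t=1..T. dual_value (\<gamma> t) \<nu> + \<nu> \<bullet> \<rho>)"
      using int_t by (intro Bochner_Integration.integrable_sum Bochner_Integration.integrable_add) auto
  qed (simp only: space_\<Omega> opt_bounds(3)[OF _ \<nu>])
  also have "\<dots> = (\<Sum>t=1..T. (\<integral>\<gamma>. dual_value (\<gamma> t) \<nu> \<partial>\<Omega>) + \<nu> \<bullet> \<rho>)"
    using int_t by (simp add: Bochner_Integration.integral_sum \<Omega>.prob_space)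
  also have "\<dots> = real T * ((\<integral>r. dual_value r \<nu> \<partial>P) + \<nu> \<bullet> \<rho>)"
    using eq_t by simp
  finally show "mean_opt \<le> (\<integral>r. dual_value r \<nu> \<partial>P) + \<nu> \<bullet> \<rho>"
    using T_pos by (simp add: mean_opt_def pos_divide_le_eq mult.commute)
qed

lemma integrable_lagrangian_gap:
  assumes "t \<in> {1..T}"
  shows "integrable \<Omega> (\<lambda>\<gamma>. if slack \<gamma> t then lagrangian \<gamma> t - mean_opt else 0)"
proof -
  let ?K = "fbar + (\<mu>1 \<bullet> \<rho> + real t * (\<rho>max * (2 * \<eta> * (bbar + \<rho>max) / \<sigma>)))"
  have "norm (if slack \<gamma> t then lagrangian \<gamma> t - mean_opt else 0) \<le> ?K + \<bar>mean_opt\<bar>"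
    if "\<gamma> \<in> space \<Omega>" for \<gamma>
    using lagrangian_bounds[OF that[unfolded space_\<Omega>] assms] by (auto simp: abs_if)
  then show ?thesis
    using assms measurable_lagrangian
    by (intro \<Omega>.integrable_const_bound[where B = "?K + \<bar>mean_opt\<bar>"] AE_I2 measurable_if_slack) auto
qed

text \<open>
  Conditionally on the past, both \<open>slack \<gamma> t\<close> and the price \<open>\<mu> \<gamma> t\<close> are constants, and weak duality
  at this price bounds \<open>mean_opt\<close>.  Since \<open>dual_value r \<nu>\<close> need not be measurable in \<open>r\<close> for every
  \<open>\<nu>\<close>, its measurability is obtained for the prices that occur, as a section of the run.
\<close>

lemma lagrangian_gap_nonneg:
  assumes t: "t \<in> {1..T}"
  shows "0 \<le> (\<integral>\<gamma>. (if slack \<gamma> t then lagrangian \<gamma> t - mean_opt else 0) \<partial>\<Omega>)"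
proof -
  define F where "F \<gamma> = (if slack \<gamma> t then lagrangian \<gamma> t - mean_opt else 0)" for \<gamma>
  define J where "J = {1..T} - {t}"
  have J: "finite J" "t \<notin> J" "insert t J = {1..T}" using t by (auto simp: J_def)
  interpret product_sigma_finite "\<lambda>_. P" by standard
  \<comment> \<open>Fubini in place of conditional expectation: only the request at time
    \<open>t\<close> is integrated inside. The later requests are frozen too, but neither slack nor
    the price at \<open>t\<close> sees them.\<close>
  have "(\<integral>\<gamma>. F \<gamma> \<partial>\<Omega>) = (\<integral>x. (\<integral>y. F (x(t := y)) \<partial>P) \<partial>(\<Pi>\<^sub>M s\<in>J. P))"
    using product_integral_insert[OF J(1,2), of F] integrable_lagrangian_gap[OF t]
    unfolding J(3) F_def \<Omega>_def by blast
  also have "0 \<le> \<dots>"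
  proof (rule Bochner_Integration.integral_nonneg)
    fix x assume x: "x \<in> space (\<Pi>\<^sub>M s\<in>J. P)"
    have path: "x(t := y) \<in> paths" if "y \<in> space P" for y
      using x that PiE_fun_upd[of y "\<lambda>_. space P" t x J] by (simp add: space_PiM J(3))
    \<comment> \<open>An arbitrary filler for coordinate \<open>t\<close>; by predictability, slack
      and price at \<open>t\<close> do not depend on it.\<close>
    obtain y0 where y0: "y0 \<in> space P" using not_empty by blast
    define \<nu> where "\<nu> = \<mu> (x(t := y0)) t"
    have \<nu>: "0 \<le> \<nu>" using \<mu>_regular[OF path[OF y0], of t] t by (simp add: \<nu>_def)
    have slack: "slack (x(t := y)) t \<longleftrightarrow> slack (x(t := y0)) t"
      and price: "\<mu> (x(t := y)) t = \<nu>" if "y \<in> space P" for y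
      unfolding \<nu>_def using that y0
      by (intro slack_predictable \<mu>_predictable path t; simp)+
    have lagr: "lagrangian (x(t := y)) t = dual_value y \<nu> + \<nu> \<bullet> \<rho>" if "y \<in> space P" for y
      using lagrangian_eq_dual_value[OF path[OF that] t] price[OF that] by simp
    have "(\<lambda>y. lagrangian (x(t := y)) t) \<in> borel_measurable P"
      using measurable_comp[OF measurable_component_update[OF x J(2)], of "\<lambda>\<gamma>. lagrangian \<gamma> t" borel]
        measurable_lagrangian[OF t] unfolding J(3) comp_def \<Omega>_def by blast
    then have "(\<lambda>y. lagrangian (x(t := y)) t - \<nu> \<bullet> \<rho>) \<in> borel_measurable P"
      by simp
    \<comment> \<open>On \<open>space P\<close> the two functions agree, so the dual function at
      this price inherits measurability from the section.\<close>
    moreover have "(\<lambda>y. lagrangian (x(t := y)) t - \<nu> \<bullet> \<rho>) \<in> borel_measurable P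
        \<longleftrightarrow> (\<lambda>r. dual_value r \<nu>) \<in> borel_measurable P"
      by (rule measurable_cong) (simp add: lagr)
    ultimately have m: "(\<lambda>r. dual_value r \<nu>) \<in> borel_measurable P" by simp
    show "0 \<le> (\<integral>y. F (x(t := y)) \<partial>P)"
    proof (cases "slack (x(t := y0)) t")
      case True
      have "(\<integral>y. F (x(t := y)) \<partial>P) = (\<integral>y. dual_value y \<nu> + (\<nu> \<bullet> \<rho> - mean_opt) \<partial>P)"
        using True by (intro Bochner_Integration.integral_cong) (simp_all add: F_def slack lagr)
      also have "\<dots> = (\<integral>y. dual_value y \<nu> \<partial>P) + (\<nu> \<bullet> \<rho> - mean_opt)"
        using mean_opt_le_dual(1)[OF \<nu> m] by (simp add: prob_space)
      finally show ?thesis using mean_opt_le_dual(2)[OF \<nu> m] by simp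
    next
      case False
      have "(\<integral>y. F (x(t := y)) \<partial>P) = (\<integral>y. 0 \<partial>P)"
        using False by (intro Bochner_Integration.integral_cong) (simp_all add: F_def slack)
      then show ?thesis by simp
    qed
  qed
  finally show ?thesis by (simp add: F_def)
qed

text \<open>The sum \<open>G\<close> of the Lagrangian gaps has nonnegative mean, so adding it to
  the regret can only raise the expectation. Pathwise, this sum is at most
  \<open>regret_bound\<close> plus a term of mean zero.\<close>

lemma expected_regret_le:
  "(\<integral>\<gamma>. opt_value T \<rho> \<gamma> - total_reward T \<gamma> (x \<gamma>) \<partial>\<Omega>) \<le> regret_bound"
proof (cases "integrable \<Omega> (\<lambda>\<gamma>. opt_value T \<rho> \<gamma> - total_reward T \<gamma> (x \<gamma>))")
  case False
  \<comment> \<open>The reward of the action \<open>0\<close> need not be measurable; the Bochner integral is then \<open>0\<close>.\<close>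
  then show ?thesis using regret_bound_nonneg by (simp add: not_integrable_integral_eq)
next
  case True
  define G where "G \<gamma> = (\<Sum>t=1..T. if slack \<gamma> t then lagrangian \<gamma> t - mean_opt else 0)" for \<gamma>
  have gap: "(opt_value T \<rho> \<gamma> - total_reward T \<gamma> (x \<gamma>)) + G \<gamma>
      \<le> opt_value T \<rho> \<gamma> - real T * mean_opt + regret_bound" if \<gamma>: "\<gamma> \<in> paths" for \<gamma>
  proof -
    \<comment> \<open>Termwise: equality at slack times; otherwise 0 is bounded by
      \<open>fbar - mean_opt\<close>.\<close>
    have "G \<gamma> \<le> (\<Sum>t=1..T. (if slack \<gamma> t then (\<rho> - use \<gamma> t) \<bullet> \<mu> \<gamma> t else fbar)
        + (if slack \<gamma> t then reward (\<gamma> t) (xt \<gamma> t) else 0) - mean_opt)"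
      unfolding G_def using mean_opt_le by (intro sum_mono) (simp add: lagrangian_def)
    also have "\<dots> = (\<Sum>t=1..T. if slack \<gamma> t then (\<rho> - use \<gamma> t) \<bullet> \<mu> \<gamma> t else fbar)
        + (\<Sum>t=1..T. if slack \<gamma> t then reward (\<gamma> t) (xt \<gamma> t) else 0) - real T * mean_opt"
      by (simp add: sum.distrib sum_subtractf)
    finally show ?thesis using pathwise_bound[OF \<gamma>] total_reward_ge[OF \<gamma>] by linarith
  qed
  have int_G: "integrable \<Omega> G"
    unfolding G_def using integrable_lagrangian_gap by (intro Bochner_Integration.integrable_sum)
  have "(\<integral>\<gamma>. G \<gamma> \<partial>\<Omega>) = (\<Sum>t=1..T. \<integral>\<gamma>. (if slack \<gamma> t then lagrangian \<gamma> t - mean_opt else 0) \<partial>\<Omega>)"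
    unfolding G_def using integrable_lagrangian_gap by (rule Bochner_Integration.integral_sum)
  then have "0 \<le> (\<integral>\<gamma>. G \<gamma> \<partial>\<Omega>)"
    by (simp only: sum_nonneg lagrangian_gap_nonneg)
  then have "(\<integral>\<gamma>. opt_value T \<rho> \<gamma> - total_reward T \<gamma> (x \<gamma>) \<partial>\<Omega>)
      \<le> (\<integral>\<gamma>. (opt_value T \<rho> \<gamma> - total_reward T \<gamma> (x \<gamma>)) + G \<gamma> \<partial>\<Omega>)"
    using Bochner_Integration.integral_add[OF True int_G] by simp
  also have "\<dots> \<le> (\<integral>\<gamma>. opt_value T \<rho> \<gamma> - real T * mean_opt + regret_bound \<partial>\<Omega>)"
    using True int_G integrable_opt gap by (intro integral_mono) (auto simp: space_\<Omega>)
  also have "\<dots> = (\<integral>\<gamma>. opt_value T \<rho> \<gamma> \<partial>\<Omega>) - real T * mean_opt + regret_bound"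
    using integrable_opt by (simp add: \<Omega>.prob_space)
  also have "\<dots> = regret_bound" using T_pos by (simp add: mean_opt_def)
  finally show ?thesis .
qed

end

text \<open>Serves step size 0 in the case where the bound collapses to 0. Without positive rewards
  the hindsight optimum is at most 0 on every path.\<close>

lemma regret_nonpos_if_no_reward:
  fixes M :: "('d::finite, 'm::finite) request measure"
  assumes valid: "\<And>r. r \<in> space M \<Longrightarrow> valid_request r" and bounded: "bounded_requests 0 bbar (space M)"
    and "0 \<le> \<rho>" and dmd: "dual_mirror_descent T \<rho> h \<eta> \<mu>1 (space M) xt x B \<mu>"
  shows "regret T \<rho> M x \<le> 0"
  unfolding regret_def
proof (rule SUP_least)
  fix P assume "P \<in> space (prob_algebra M)"
  then have space: "space P = space M"
    by (intro sets_eq_imp_space_eq) (simp add: space_prob_algebra)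
  have "opt_value T \<rho> \<gamma> - total_reward T \<gamma> (x \<gamma>) \<le> 0" if \<gamma>: "\<gamma> \<in> {1..T} \<rightarrow>\<^sub>E space M" for \<gamma>
  proof -
    have in_M: "\<gamma> t \<in> space M" if "t \<in> {1..T}" for t using \<gamma> that by auto
    have "mirror_descent_run T \<rho> h \<eta> \<mu>1 \<gamma> (xt \<gamma>) (x \<gamma>) (B \<gamma>) (\<mu> \<gamma>)"
      using dmd \<gamma> unfolding dual_mirror_descent_def by blast
    then have "x \<gamma> t \<in> actions (\<gamma> t)" if "t \<in> {1..T}" for t
      using that valid[OF in_M[OF that]] by (rule mirror_descent_run_actions)
    then have "0 \<le> total_reward T \<gamma> (x \<gamma>)"
      unfolding total_reward_def using in_M by (intro sum_nonneg request_boundsD(1)[OF bounded])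
    moreover have "opt_value T \<rho> \<gamma> \<le> 0"
      using opt_value_bounds(2)[OF bounded _ \<open>0 \<le> \<rho>\<close>, of T \<gamma>] in_M valid by simp
    ultimately show ?thesis by simp
  qed
  \<comment> \<open>The sign rule for integrals is applied to the negated integrand, since it holds
    for non-integrable functions as well, through the default value 0.\<close>
  then have "0 \<le> (\<integral>\<gamma>. - (opt_value T \<rho> \<gamma> - total_reward T \<gamma> (x \<gamma>)) \<partial>(\<Pi>\<^sub>M t\<in>{1..T}. P))"
    by (intro Bochner_Integration.integral_nonneg) (simp add: space_PiM space)
  then show "ereal (\<integral>\<gamma>. opt_value T \<rho> \<gamma> - total_reward T \<gamma> (x \<gamma>) \<partial>(\<Pi>\<^sub>M t\<in>{1..T}. P)) \<le> 0"
    unfolding Bochner_Integration.integral_minus by simp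
qed

theorem theorem1:
  fixes M :: "('d::finite, 'm::finite) request measure"
    and \<rho> \<mu>1 :: "real ^ 'm"
    and h :: "real ^ 'm \<Rightarrow> real"
    and \<sigma> \<eta> fbar bbar :: real
    and T :: nat
    and xt x :: "(nat \<Rightarrow> ('d, 'm) request) \<Rightarrow> nat \<Rightarrow> real ^ 'd"
    and B \<mu> :: "(nat \<Rightarrow> ('d, 'm) request) \<Rightarrow> nat \<Rightarrow> real ^ 'm"
  assumes "T \<ge> 1"
    and "\<And>j. 0 < \<rho> $ j"
    and "\<And>r. r \<in> space M \<Longrightarrow> valid_request r"
    and "bounded_requests fbar bbar (space M)"
    and "reference_function \<sigma> h"
    and "0 \<le> \<eta>"
    and "0 \<le> \<mu>1"
    and "h differentiable (at \<mu>1 within {0..})"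
    and "dual_mirror_descent T \<rho> h \<eta> \<mu>1 (space M) xt x B \<mu>"
    and "measurable_execution T \<rho> M xt \<mu>"
  defines "C1 \<equiv> fbar * bbar / Min (range (\<lambda>j. \<rho> $ j))"
    and "C2 \<equiv> (bbar + Max (range (\<lambda>j. \<rho> $ j)))\<^sup>2 / (2 * \<sigma>)"
    and "C3 \<equiv> Max ((\<lambda>v. bregman h v \<mu>1) ` insert 0 (range (\<lambda>j. axis j (fbar / \<rho> $ j))))"
  shows "regret T \<rho> M x \<le> ereal (C1 + C2 * \<eta> * real T) + ereal C3 / ereal \<eta>"
proof (cases "\<eta> = 0")
  case True
  let ?V = "insert 0 (range (\<lambda>j. axis j (fbar / \<rho> $ j)))"
  have fbar: "0 \<le> fbar" using assms(4) by (simp add: bounded_requests_def)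
  have V_nonneg: "0 \<le> v" if "v \<in> ?V" for v
    using that fbar assms(2) by (auto simp: nonneg_vec_iff axis_def less_imp_le)
  have le_C3: "bregman h v \<mu>1 \<le> C3" if "v \<in> ?V" for v
    unfolding C3_def using that by (intro Max_ge) auto
  have "0 \<le> bregman h 0 \<mu>1"
    by (rule bregman_nonneg[OF assms(5) _ assms(7,8)]) simp
  then have "0 \<le> C3" using le_C3[of 0] by simp
  then consider "0 < C3" | "C3 = 0" by linarith
  then show ?thesis
  proof cases
    case 1
    \<comment> \<open>Here \<open>C3 / 0\<close> is infinite and the bound is trivial.\<close>
    then show ?thesis by (simp add: True)
  next
    case 2
    \<comment> \<open>If \<open>C3 = 0\<close>, strong convexity makes every comparator equal to
      \<open>\<mu>1\<close>. The comparators, 0 among them, then coincide, so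
      \<open>fbar = 0\<close>; with \<open>0 / 0 = 0\<close> the right-hand side is 0.\<close>
    have eq: "v = \<mu>1" if "v \<in> ?V" for v
    proof -
      have "\<sigma> / 2 * (l1_norm (v - \<mu>1))\<^sup>2 \<le> 0"
        using bregman_ge[OF assms(5) V_nonneg[OF that] assms(7,8)] le_C3[OF that] 2 by simp
      moreover have "0 < \<sigma>" using assms(5) by (simp add: reference_function_def)
      ultimately have "(l1_norm (v - \<mu>1))\<^sup>2 \<le> 0" by (simp add: mult_le_0_iff)
      then show ?thesis by (simp add: l1_norm_eq_0_iff)
    qed
    have "axis j (fbar / \<rho> $ j) = (0 :: real ^ 'm)" for j
      using eq[of 0] eq[of "axis j (fbar / \<rho> $ j)"] by blast
    then have "fbar / \<rho> $ j = 0" for j by (metis axis_eq_0_iff)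
    then have "fbar = 0" using assms(2) by (metis divide_eq_0_iff less_irrefl)
    moreover have "0 \<le> \<rho>" using assms(2) by (simp add: nonneg_vec_iff order.strict_implies_order)
    ultimately have "regret T \<rho> M x \<le> 0"
      using regret_nonpos_if_no_reward assms(3,4,9) by blast
    then show ?thesis using \<open>fbar = 0\<close> 2 by (simp add: True C1_def zero_ereal_def[symmetric])
  qed
next
  case False
  show ?thesis
    unfolding regret_def
  proof (rule SUP_least)
    fix P assume "P \<in> space (prob_algebra M)"
    then have P: "sets P = sets M" "prob_space P" by (simp_all add: space_prob_algebra)
    have space: "space P = space M" using P(1) by (rule sets_eq_imp_space_eq)
    \<comment> \<open>The run is the same for every distribution; only the measure changes, so the
      bound is uniform and passes to the supremum.\<close>
    interpret iid_dual_mirror_descent_run P \<rho> \<mu>1 h \<sigma> \<eta> fbar bbar T xt x B \<mu>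
    proof (intro iid_dual_mirror_descent_run.intro dual_mirror_descent_run.intro
        iid_dual_mirror_descent_run_axioms.intro)
      show "0 < \<eta>" using assms(6) False by simp
      show "measurable_execution T \<rho> P xt \<mu>"
        using assms(10) measurable_execution_cong[OF P(1)] by blast
    qed (simp_all only: space assms(1-5,7-9) P(2))
    have "regret_bound = C1 + C2 * \<eta> * real T + C3 / \<eta>"
      by (simp add: regret_bound_def \<rho>min_def \<rho>max_def C1_def C2_def C3_def)
    then show "ereal (\<integral>\<gamma>. opt_value T \<rho> \<gamma> - total_reward T \<gamma> (x \<gamma>) \<partial>(\<Pi>\<^sub>M t\<in>{1..T}. P))
        \<le> ereal (C1 + C2 * \<eta> * real T) + ereal C3 / ereal \<eta>"
      using expected_regret_le False by (simp add: \<Omega>_def)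
  qed
qed

end
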